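(* For integers $k \ge 1$ and $n \ge 2k+1$, let $G$ be the $k$-nearest-neighbor circulant graph on $n$ vertices and let $L$ be its graph Laplacian. (1) For all sufficiently large $n$, the $k$-nearest-neighbor circulant graph of size $n$ has an unsynchronized stable equilibrium whenever $\frac{\lambda_n(L)}{\lambda_2(L)} > 2$. (2) If $n, k \to \infty$ with $\frac{2k}{n} \to \mu \ge 0.6$, then $\frac{\lambda_n(L)}{\lambda_2(L)} \to \kappa(\mu)$, where $\kappa$ is an analytic and strictly decreasing function on $[0.6, 1]$ such that $\kappa(\mu_c) = 2$. (3) Consequently, for every $\epsilon > 0$, there exists a $k$-nearest-neighbor circulant graph (for some $n$ and $k$) with an unsynchronized stable equilibrium and $\frac{\lambda_n(L)}{\lambda_2(L)} \le 2 + \epsilon$.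
   Context: The $k$-nearest-neighbor circulant graph on $n \ge 2k+1$ vertices has vertices $1, \dots, n$, with vertex $i$ adjacent to $i-k, \dots, i-1, i+1, \dots, i+k$ (indices modulo $n$). With $A$ its adjacency matrix, its graph Laplacian is $L = \operatorname{diag}(A\mathbf{1}) - A$. The eigenvalues of a symmetric $n\times n$ matrix $M$ are denoted in increasing order $\lambda_1(M) \le \cdots \le \lambda_n(M)$. Equilibria are those of the Kuramoto dynamics on the graph, $$ \frac{d\theta_i}{dt} = K \sum_{j=1}^n A_{ij} \sin(\theta_j - \theta_i), \qquad i = 1, \dots, n, $$ with a constant $K > 0$ (whose value only affects the time scale). An equilibrium is unsynchronized if it is not of the form $\theta_1 = \cdots = \theta_n \bmod 2\pi$. It is stable if the Jacobian of the dynamics at the equilibrium has strictly negative eigenvalues except for the (simple) zero eigenvalue in the trivial direction $\mathbf{1}$ corresponding to shifting all angles equally. The constant $\mu_c \approx 0.68$ is the critical density of Wiley, Strogatz, and Girvan, namely the unique solution $\mu \in [0.6, 1]$ of $$ 2\left(1 - \frac{\sin(\pi\mu)}{\pi\mu}\right) = 1 - \frac{\sin(2\pi\mu)}{2\pi\mu}. $$ *)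

theory Defs
  imports
    "HOL-Analysis.Derivative"
    "HOL-Number_Theory.Cong"
    "HOL-Library.Real_Mod"
    "Jordan_Normal_Form.Char_Poly"
begin

text \<open>
  Vertices are \<open>0, \<dots>, n - 1\<close>, the indices of matrices and vectors in
  \<^theory>\<open>Jordan_Normal_Form.Matrix\<close>.
\<close>
definition circulant_adj :: "nat \<Rightarrow> nat \<Rightarrow> real mat" where
  "circulant_adj n k = mat n n (\<lambda>(i, j).
     if \<exists>d\<in>{1..k}. [j = i + d] (mod n) \<or> [i = j + d] (mod n) then 1 else 0)"

definition laplacian :: "real mat \<Rightarrow> real mat" where
  "laplacian A =
     (let n = dim_row A in mat_diag n (\<lambda>i. (A *\<^sub>v vec n (\<lambda>_. 1)) $ i) - A)"

text \<open>
  The \<open>i\<close>-th smallest eigenvalue, counted with multiplicity, for \<open>i\<close> from 1 to the dimension.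
  A real symmetric matrix has all \<open>n\<close> roots of its characteristic polynomial in the reals, so the
  list below then has length \<open>n\<close>.
\<close>
definition ith_eigenvalue :: "nat \<Rightarrow> real mat \<Rightarrow> real" where
  "ith_eigenvalue i M = sorted_list_of_multiset (proots (char_poly M)) ! (i - 1)"

definition laplacian_ratio :: "nat \<Rightarrow> nat \<Rightarrow> real" where
  "laplacian_ratio n k =
     (let L = laplacian (circulant_adj n k) in ith_eigenvalue n L / ith_eigenvalue 2 L)"

definition kuramoto_field :: "real \<Rightarrow> real mat \<Rightarrow> real vec \<Rightarrow> real vec" where
  "kuramoto_field K A \<theta> =
     vec (dim_row A) (\<lambda>i. K * (\<Sum>j<dim_row A. A $$ (i, j) * sin (\<theta> $ j - \<theta> $ i)))"

definition jacobian :: "nat \<Rightarrow> (real vec \<Rightarrow> real vec) \<Rightarrow> real vec \<Rightarrow> real mat" where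
  "jacobian n F \<theta> = mat n n (\<lambda>(i, j). deriv (\<lambda>t. F (\<theta> + t \<cdot>\<^sub>v unit_vec n j) $ i) 0)"

definition equilibrium :: "real \<Rightarrow> real mat \<Rightarrow> real vec \<Rightarrow> bool" where
  "equilibrium K A \<theta> \<longleftrightarrow>
     \<theta> \<in> carrier_vec (dim_row A) \<and> kuramoto_field K A \<theta> = 0\<^sub>v (dim_row A)"

definition unsynchronized :: "real vec \<Rightarrow> bool" where
  "unsynchronized \<theta> \<longleftrightarrow>
     \<not> (\<forall>i<dim_vec \<theta>. \<forall>j<dim_vec \<theta>. [\<theta> $ i = \<theta> $ j] (rmod (2 * pi)))"

text \<open>
  Quantifying over real eigenvalues only is no restriction: for a symmetric \<open>A\<close> the Jacobian is
  symmetric.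
\<close>
definition stable_equilibrium :: "real \<Rightarrow> real mat \<Rightarrow> real vec \<Rightarrow> bool" where
  "stable_equilibrium K A \<theta> \<longleftrightarrow> equilibrium K A \<theta> \<and>
     (let n = dim_row A; J = jacobian n (kuramoto_field K A) \<theta> in
        eigenvector J (vec n (\<lambda>_. 1)) 0 \<and>
        Polynomial.order 0 (char_poly J) = 1 \<and>
        (\<forall>x. eigenvalue J x \<and> x \<noteq> 0 \<longrightarrow> x < 0))"

definition critical_density :: real where
  "critical_density = (THE m. m \<in> {0.6..1} \<and>
     2 * (1 - sin (pi * m) / (pi * m)) = 1 - sin (2 * pi * m) / (2 * pi * m))"

text \<open>
  Real analyticity at every point of \<open>S\<close>: the function agrees with a convergent power series on a
  full real neighbourhood of the point. On a closed interval this means analyticity on an open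
  interval containing it, so values outside \<open>S\<close> serve as the analytic extension.
\<close>
definition real_analytic_on :: "(real \<Rightarrow> real) \<Rightarrow> real set \<Rightarrow> bool" where
  "real_analytic_on f S \<longleftrightarrow> (\<forall>x\<in>S. \<exists>r>0. \<exists>a :: nat \<Rightarrow> real.
     \<forall>y. \<bar>y - x\<bar> < r \<longrightarrow> (\<lambda>m. a m * (y - x) ^ m) sums f y)"

end

theory Submission
  imports Defs "HOL-Complex_Analysis.Cauchy_Integral_Formula" "HOL-Real_Asymp.Real_Asymp"
begin

text \<open>
  The equilibrium is the twisted state \<open>\<theta>\<^sub>i = 2 \<pi> i / n\<close>. Both the graph Laplacian and minus
  the Jacobian at the twisted state are weighted circulant Laplacians, so the Fourier basis diagonalises
  them: \<open>L\<close> has eigenvalues \<open>\<lambda>(p) = 2k + 1 - D(p)\<close> with the Dirichlet kernel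
  \<open>D(p) = sin ((2k + 1) p h) / sin (p h)\<close>, \<open>h = \<pi> / n\<close>, and the Jacobian has eigenvalues
  \<open>- (K / 2) (\<lambda>(p + 1) + \<lambda>(p - 1) - 2 \<lambda>(1))\<close>. The minimum of \<open>\<lambda>\<close> over
  \<open>0 < p < n\<close> is \<open>\<lambda>(1)\<close>, so stability reduces to the case \<open>p = 1\<close>, that is to
  \<open>\<lambda>(2) > 2 \<lambda>(1)\<close>. If \<open>2k + 1 \<le> 2n / 3\<close>, this holds for every \<open>n \<ge> 5\<close>.
  At densities above about 0.59 and for large \<open>n\<close>, the maximum of \<open>\<lambda>\<close> is
  \<open>\<lambda>(2)\<close>, so the condition says exactly that the eigenvalue ratio exceeds 2, and the ratio
  tends to \<open>(2t - sin 2t) / (2 (t - sin t))\<close> with \<open>t = \<pi> \<mu>\<close>.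
  Both extremal statements rest on the monotonicity of \<open>sin (M x) / sin x\<close> for \<open>M x \<le> \<pi> / 2\<close>;
  beyond that range one passes to the complementary angle \<open>b = \<pi> - (2k + 1) h\<close>, which changes
  only the sign of \<open>D(p)\<close>.
\<close>

unbundle no vec_syntax

section \<open>Spectra of circulant Laplacians\<close>

lemma sum_periodic_shift:
  fixes f :: "int \<Rightarrow> 'a :: ab_group_add"
  assumes per: "\<And>d. f (d + int n) = f d"
  shows "(\<Sum>j<n. f (int j + c)) = (\<Sum>j<n. f (int j))"
proof -
  \<comment> \<open>Advancing the window by one drops \<open>f c\<close> and adds
    \<open>f (c + int n)\<close>, which are equal; integer induction then runs in both
    directions.\<close>
  have step: "(\<Sum>j<n. f (int j + (c + 1))) = (\<Sum>j<n. f (int j + c))" for c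
  proof -
    have "(\<Sum>j<n. f (int (Suc j) + c)) + f c = (\<Sum>j<Suc n. f (int j + c))"
      by (subst sum.lessThan_Suc_shift) simp
    also have "\<dots> = (\<Sum>j<n. f (int j + c)) + f c"
      using per[of c] by (simp add: add.commute)
    finally show ?thesis by (simp add: algebra_simps)
  qed
  show ?thesis
  proof (induction c rule: int_induct[of _ 0])
    case base
    then show ?case by simp
  next
    case (step1 i)
    then show ?case using step[of i] by simp
  next
    case (step2 i)
    then show ?case using step[of "i - 1"] by simp
  qed
qed

text \<open>The reflection \<open>d\<close> to \<open>- d\<close> permutes the residues modulo
  \<open>n\<close>, so the sum equals its own negative. This kills the imaginary part of the Fourier
  symbol and the net force at the twisted state.\<close>

lemma sum_odd_periodic:
  fixes f :: "int \<Rightarrow> real"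
  assumes per: "\<And>d. f (d + int n) = f d" and odd: "\<And>d. f (- d) = - f d"
  shows "(\<Sum>j<n. f (int j)) = 0"
proof -
  have "(\<Sum>j<n. f (int j)) = (\<Sum>j<n. f (int (n - Suc j)))"
    by (rule sum.nat_diff_reindex[symmetric])
  also have "\<dots> = (\<Sum>j<n. - f (int j + 1))"
  proof (rule sum.cong)
    fix j assume "j \<in> {..<n}"
    then have "int (n - Suc j) = - (int j + 1) + int n" by auto
    then show "f (int (n - Suc j)) = - f (int j + 1)"
      using per odd by metis
  qed simp
  also have "\<dots> = - (\<Sum>j<n. f (int j))"
    using sum_periodic_shift[of f n 1, OF per] by (simp add: sum_negf)
  finally show ?thesis by simp
qed

lemma map_poly_of_real_prod_linear:
  "map_poly complex_of_real (\<Prod>i\<in>S. [:- f i, 1:]) = (\<Prod>i\<in>S. [:- complex_of_real (f i), 1:])"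
proof -
  interpret h: map_poly_comm_ring_hom complex_of_real ..
  show ?thesis by (simp add: h.hom_prod)
qed

lemma cis_periodic:
  assumes "n > 0"
  shows "cis (2 * pi * real p * real_of_int (d + int n) / real n) =
    cis (2 * pi * real p * real_of_int d / real n)"
proof -
  have "2 * pi * real p * real_of_int (d + int n) / real n =
      2 * pi * real p * real_of_int d / real n + 2 * pi * real p"
    using assms by (simp add: field_simps)
  moreover have "cis (2 * pi * real p) = 1"
    using cis_multiple_2pi[of "real p"] by simp
  ultimately show ?thesis by (simp add: cis_mult[symmetric])
qed

text \<open>Off the diagonal this is the geometric sum of an \<open>n\<close>-th root of unity; that
  root is not 1, since \<open>n\<close> cannot divide the nonzero number \<open>i - j\<close> of
  absolute value below \<open>n\<close>.\<close>

lemma sum_cis_orthogonal: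
  assumes "i < n" "j < n"
  shows "(\<Sum>p<n. cis (2 * pi * real p * (real i - real j) / real n)) = (if i = j then of_nat n else 0)"
proof (cases "i = j")
  case False
  define z where "z = cis (2 * pi * (real i - real j) / real n)"
  have pow: "cis (2 * pi * real p * (real i - real j) / real n) = z ^ p" for p
    unfolding z_def by (simp add: Complex.DeMoivre mult.commute mult.left_commute)
  have "z ^ n = 1"
    unfolding pow[symmetric] using assms cis_multiple_2pi[of "real i - real j"] by (simp add: mult.assoc)
  moreover have "z \<noteq> 1"
  proof
    assume "z = 1"
    then have "cos (2 * pi * (real i - real j) / real n) = 1"
      unfolding z_def by (metis cis.sel(1) one_complex.sel(1))
    then obtain m :: int where "2 * pi * (real i - real j) / real n = of_int m * 2 * pi"
      unfolding cos_one_2pi_int by auto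
    then have "2 * pi * (real i - real j) = 2 * pi * (of_int m * real n)"
      using assms by (simp add: field_simps)
    then have "real i - real j = of_int m * real n" by simp
    then have "real_of_int (int i - int j) = real_of_int (m * int n)" by simp
    then have "int i - int j = m * int n" by (simp only: of_int_eq_iff)
    moreover have "\<bar>int i - int j\<bar> < int n" using assms by auto
    ultimately have "m = 0" using assms
      by (metis abs_mult abs_of_nat mult_le_cancel_right1 not_less of_nat_0_le_iff zero_less_abs_iff
          int_one_le_iff_zero_less le_less_trans)
    then show False using \<open>int i - int j = m * int n\<close> False by simp
  qed
  ultimately show ?thesis using False unfolding pow by (simp add: geometric_sum)
qed simp

text \<open>The Fourier vectors diagonalise the matrix over the complex numbers; evenness of
  \<open>w\<close> makes the eigenvalues real, and comparing coefficients under the injective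
  \<open>of_real\<close> brings the factorisation back to the reals. The sign of \<open>w\<close> is
  unrestricted, so the Jacobian is covered as well as the graph Laplacian.\<close>

lemma char_poly_circulant_laplacian:
  fixes w :: "int \<Rightarrow> real"
  assumes per: "\<And>d. w (d + int n) = w d" and even: "\<And>d. w (- d) = w d"
  shows "char_poly (mat n n (\<lambda>(i, j). (if i = j then \<Sum>d<n. w (int d) else 0) - w (int j - int i)))
    = (\<Prod>p<n. [:- (\<Sum>d<n. w (int d) * (1 - cos (2 * pi * real p * real d / real n))), 1:])"
    (is "char_poly ?M = (\<Prod>p<n. [:- ?\<nu> p, 1:])")
proof (cases "n = 0")
  case True
  then show ?thesis by (simp add: char_poly_def det_def char_poly_matrix_def)
next
  case False
  define e where "e p d = cis (2 * pi * real p * real_of_int d / real n)" for p and d :: int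
  define W where "W = (\<Sum>d<n. w (int d))"
  define P where "P = mat n n (\<lambda>(i, p). e p (int i))"
  define Q where "Q = mat n n (\<lambda>(p, i). e p (- int i) / of_nat n)"
  define B where "B = mat_diag n (\<lambda>p. complex_of_real (?\<nu> p))"
  define C where "C = map_mat complex_of_real ?M"
  have e_add: "e p (c + d) = e p c * e p d" for p c d
    unfolding e_def cis_mult by (rule arg_cong[where f = cis]) (simp add: field_simps add_divide_distrib)
  have e_per: "e p (d + int n) = e p d" for p d
    unfolding e_def using cis_periodic False by simp
  \<comment> \<open>The imaginary part is a full-period sum of an even weight times a sine, hence of
    an odd function.\<close>
  have symbol: "(\<Sum>d<n. complex_of_real (w (int d)) * e p (int d)) = complex_of_real (W - ?\<nu> p)" for p
  proof (rule complex_eqI)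
    have "(\<Sum>d<n. (\<lambda>d. w d * Im (e p d)) (int d)) = 0"
      by (rule sum_odd_periodic) (simp_all add: per e_per even, simp add: e_def)
    then show "Im (\<Sum>d<n. complex_of_real (w (int d)) * e p (int d)) = Im (complex_of_real (W - ?\<nu> p))"
      by simp
    show "Re (\<Sum>d<n. complex_of_real (w (int d)) * e p (int d)) = Re (complex_of_real (W - ?\<nu> p))"
      by (simp add: e_def W_def sum_subtractf[symmetric] algebra_simps)
  qed
  have CP: "C * P = P * B"
  proof (rule eq_matI)
    fix i p assume ip: "i < dim_row (P * B)" "p < dim_col (P * B)"
    then have i: "i < n" and p: "p < n" by (auto simp: P_def B_def mat_diag_def)
    have "(C * P) $$ (i, p) = (\<Sum>j<n. C $$ (i, j) * P $$ (j, p))"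
      using i p by (simp add: C_def P_def scalar_prod_def atLeast0LessThan)
    also have "\<dots> = (\<Sum>j<n. (if i = j then of_real W * e p (int i) else 0)
        - e p (int i) * (complex_of_real (w (int j - int i)) * e p (int j - int i)))"
    proof (rule sum.cong)
      fix j assume "j \<in> {..<n}"
      moreover have "e p (int i) * e p (int j - int i) = e p (int j)"
        using e_add[of p "int i" "int j - int i"] by simp
      moreover have "e p 0 = 1" by (simp add: e_def)
      ultimately show "C $$ (i, j) * P $$ (j, p) = (if i = j then of_real W * e p (int i) else 0)
        - e p (int i) * (complex_of_real (w (int j - int i)) * e p (int j - int i))"
        using i p by (simp add: C_def P_def W_def algebra_simps)
    qed simp
    also have "\<dots> = of_real W * e p (int i)
        - e p (int i) * (\<Sum>j<n. complex_of_real (w (int j - int i)) * e p (int j - int i))"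
      using i by (simp add: sum_subtractf sum_distrib_left)
    also have "(\<Sum>j<n. complex_of_real (w (int j - int i)) * e p (int j - int i))
        = (\<Sum>d<n. complex_of_real (w (int d)) * e p (int d))"
      using sum_periodic_shift[of "\<lambda>d. complex_of_real (w d) * e p d" n "- int i"] per e_per by simp
    also have "of_real W * e p (int i) - e p (int i) * \<dots> = e p (int i) * of_real (?\<nu> p)"
      unfolding symbol by (simp add: algebra_simps)
    also have "\<dots> = (P * B) $$ (i, p)"
      using i p by (simp add: P_def B_def mat_diag_mult_right[of _ n n])
    finally show "(C * P) $$ (i, p) = (P * B) $$ (i, p)" .
  qed (auto simp: C_def P_def B_def mat_diag_def)
  have carr [simp]: "P \<in> carrier_mat n n" "Q \<in> carrier_mat n n" "B \<in> carrier_mat n n" "C \<in> carrier_mat n n"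
    by (auto simp: P_def Q_def B_def C_def mat_diag_def)
  have PQ: "P * Q = 1\<^sub>m n"
  proof (rule eq_matI)
    fix i j assume "i < dim_row (1\<^sub>m n :: complex mat)" "j < dim_col (1\<^sub>m n :: complex mat)"
    then have i: "i < n" and j: "j < n" by auto
    have "(P * Q) $$ (i, j) = (\<Sum>p<n. e p (int i) * (e p (- int j) / of_nat n))"
      using i j by (simp add: P_def Q_def scalar_prod_def atLeast0LessThan)
    also have "\<dots> = (\<Sum>p<n. e p (int i - int j)) / of_nat n"
      using e_add[of _ "int i" "- int j"] by (simp add: sum_divide_distrib)
    also have "\<dots> = 1\<^sub>m n $$ (i, j)"
      using sum_cis_orthogonal[OF i j] i j False by (simp add: e_def)
    finally show "(P * Q) $$ (i, j) = 1\<^sub>m n $$ (i, j)" .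
  qed (auto simp: P_def Q_def)
  have "C = C * (P * Q)" using right_mult_one_mat[OF carr(4)] PQ by simp
  also have "\<dots> = P * B * Q" using CP assoc_mult_mat[OF carr(4,1,2)] by simp
  finally have "similar_mat C B"
    using carr PQ mat_mult_left_right_inverse[OF carr(1,2) PQ]
    by (intro similar_matI[of C B P Q n]) (blast+)
  then have "char_poly C = char_poly B" by (rule char_poly_similar)
  also have "\<dots> = (\<Prod>a\<leftarrow>diag_mat B. [:- a, 1:])"
    by (rule char_poly_upper_triangular[OF carr(3)]) (auto simp: B_def mat_diag_def)
  also have "\<dots> = (\<Prod>p<n. [:- complex_of_real (?\<nu> p), 1:])"
    by (auto simp: diag_mat_def B_def mat_diag_def prod.distinct_set_conv_list[symmetric]
        atLeast0LessThan intro!: prod.cong)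
  finally have "map_poly complex_of_real (char_poly ?M)
      = map_poly complex_of_real (\<Prod>p<n. [:- ?\<nu> p, 1:])" (is "?p = ?q")
    unfolding map_poly_of_real_prod_linear C_def
    by (subst (asm) of_real_hom.char_poly_hom[of _ n]) auto
  then have "coeff ?p i = coeff ?q i" for i by (rule arg_cong)
  then have "complex_of_real (coeff (char_poly ?M) i) = complex_of_real (coeff (\<Prod>p<n. [:- ?\<nu> p, 1:]) i)" for i
    unfolding coeff_map_poly[of complex_of_real, OF of_real_0] .
  then show ?thesis
    by (intro poly_eqI) (simp only: of_real_eq_iff)
qed

section \<open>The nearest-neighbour graph and its twisted state\<close>

definition circulant_eigenvalue :: "nat \<Rightarrow> nat \<Rightarrow> nat \<Rightarrow> real" where
  "circulant_eigenvalue n k p = 2 * (\<Sum>d=1..k. 1 - cos (2 * pi * real p * real d / real n))"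

text \<open>Adjacency as a function of the integer offset \<open>j - i\<close>. Working on integers
  lets periodicity and evenness, the two properties of a circulant symbol, be stated
  directly.\<close>

definition neighbour_weight :: "nat \<Rightarrow> nat \<Rightarrow> int \<Rightarrow> real" where
  "neighbour_weight n k d =
     (if \<exists>e\<in>{1..k}. [d = int e] (mod int n) \<or> [d = - int e] (mod int n) then 1 else 0)"

lemma neighbour_weight_periodic: "neighbour_weight n k (d + int n) = neighbour_weight n k d"
  unfolding neighbour_weight_def Cong.cong_def mod_add_self2 by (rule refl)

lemma neighbour_weight_even: "neighbour_weight n k (- d) = neighbour_weight n k d"
proof -
  have "[- d = - int e] (mod int n) \<longleftrightarrow> [d = int e] (mod int n)" for e
    by (simp only: cong_minus_minus_iff)
  moreover have "[- d = int e] (mod int n) \<longleftrightarrow> [d = - int e] (mod int n)" for e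
    using cong_minus_minus_iff[of d "- int e"] by (simp only: minus_minus)
  ultimately show ?thesis unfolding neighbour_weight_def by (simp only: disj_commute)
qed

lemma circulant_adj_eq:
  "circulant_adj n k = mat n n (\<lambda>(i, j). neighbour_weight n k (int j - int i))"
proof (rule eq_matI)
  fix i j assume "i < dim_row (mat n n (\<lambda>(i, j). neighbour_weight n k (int j - int i)))"
    "j < dim_col (mat n n (\<lambda>(i, j). neighbour_weight n k (int j - int i)))"
  then have ij: "i < n" "j < n" by auto
  have "[j = i + d] (mod n) \<longleftrightarrow> [int j - int i = int d] (mod int n)" for d
    unfolding cong_int_iff[symmetric] cong_iff_dvd_diff by (simp add: algebra_simps)
  moreover have "[i = j + d] (mod n) \<longleftrightarrow> [int j - int i = - int d] (mod int n)" for d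
    using dvd_minus_iff[of "int n" "int i - int j - int d"]
    unfolding cong_int_iff[symmetric] cong_iff_dvd_diff by (simp add: algebra_simps)
  ultimately show "circulant_adj n k $$ (i, j) =
      mat n n (\<lambda>(i, j). neighbour_weight n k (int j - int i)) $$ (i, j)"
    using ij by (simp add: circulant_adj_def neighbour_weight_def)
qed (auto simp: circulant_adj_def)

text \<open>Forward neighbours have offsets \<open>1\<close> to \<open>k\<close>, backward ones
  \<open>n - k\<close> to \<open>n - 1\<close>; the bound on \<open>k\<close> keeps the two ranges
  disjoint.\<close>

lemma neighbour_weight_of_nat:
  assumes "2 * k + 1 \<le> n" "d < n"
  shows "neighbour_weight n k (int d) = (if d \<in> {1..k} \<union> {n - k..<n} then 1 else 0)"
proof -
  have 1: "[int d = int e] (mod int n) \<longleftrightarrow> d = e" if "e \<in> {1..k}" for e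
    using that assms by (simp add: cong_int_iff Cong.cong_def)
  have 2: "[int d = - int e] (mod int n) \<longleftrightarrow> d + e = n" if e: "e \<in> {1..k}" for e
  proof -
    have "[int d = - int e] (mod int n) \<longleftrightarrow> int n dvd int (d + e)"
      unfolding cong_iff_dvd_diff by simp
    also have "\<dots> \<longleftrightarrow> n dvd d + e" by (rule of_nat_dvd_iff)
    also have "\<dots> \<longleftrightarrow> d + e = n"
    proof
      assume "n dvd d + e"
      then obtain c where c: "d + e = n * c" by auto
      \<comment> \<open>Strictly between 0 and \<open>2 * n\<close> the only multiple of
        \<open>n\<close> is \<open>n\<close> itself.\<close>
      have "d + e < n * 2" "0 < d + e" using e assms by auto
      then have "c < 2" "0 < c" unfolding c by simp_all
      then have "c = 1" by simp
      then show "d + e = n" using c by simp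
    qed auto
    finally show ?thesis .
  qed
  have "(\<exists>e\<in>{1..k}. [int d = int e] (mod int n) \<or> [int d = - int e] (mod int n)) \<longleftrightarrow>
      (\<exists>e\<in>{1..k}. d = e \<or> d + e = n)"
    by (intro bex_cong refl) (simp only: 1 2)
  also have "\<dots> \<longleftrightarrow> d \<in> {1..k} \<union> {n - k..<n}"
  proof
    assume "d \<in> {1..k} \<union> {n - k..<n}"
    then show "\<exists>e\<in>{1..k}. d = e \<or> d + e = n"
    proof
      assume "d \<in> {n - k..<n}"
      then have "n - d \<in> {1..k}" "d + (n - d) = n" using assms by auto
      then show ?thesis by blast
    qed auto
  qed (use assms in auto)
  finally show ?thesis unfolding neighbour_weight_def by simp
qed

text \<open>The reflection \<open>d\<close> to \<open>n - d\<close> folds the backward neighbours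
  onto the forward ones, whence the factor 2.\<close>

lemma sum_neighbour_weight:
  assumes n: "2 * k + 1 \<le> n"
    and per: "\<And>d. h (d + int n) = h d" and even: "\<And>d. h (- d) = h d"
  shows "(\<Sum>d<n. neighbour_weight n k (int d) * h (int d)) = 2 * (\<Sum>d=1..k. h (int d))"
proof -
  have "(\<Sum>d<n. neighbour_weight n k (int d) * h (int d))
      = (\<Sum>d<n. if d \<in> {1..k} \<union> {n - k..<n} then h (int d) else 0)"
    using neighbour_weight_of_nat[OF n] by (intro sum.cong) auto
  also have "\<dots> = (\<Sum>d\<in>{1..k} \<union> {n - k..<n}. h (int d))"
    using n by (subst sum.inter_restrict[symmetric]) (auto intro!: sum.cong)
  also have "\<dots> = (\<Sum>d=1..k. h (int d)) + (\<Sum>d=n-k..<n. h (int d))"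
    using n by (intro sum.union_disjoint) auto
  also have "(\<Sum>d=n-k..<n. h (int d)) = (\<Sum>d=1..k. h (int d))"
  proof (rule sum.reindex_bij_witness[where i = "\<lambda>d. n - d" and j = "\<lambda>d. n - d"])
    fix d assume "d \<in> {n - k..<n}"
    then have "int d = - int (n - d) + int n" by auto
    then have "h (int d) = h (- int (n - d) + int n)" by (rule arg_cong)
    also have "\<dots> = h (int (n - d))" unfolding per by (rule even)
    finally show "h (int (n - d)) = h (int d)" by (rule sym)
  qed (use n in auto)
  finally show ?thesis by simp
qed

lemma laplacian_circulant_adj:
  "laplacian (circulant_adj n k) = mat n n (\<lambda>(i, j).
     (if i = j then \<Sum>d<n. neighbour_weight n k (int d) else 0) - neighbour_weight n k (int j - int i))"
proof -
  have shift: "(\<Sum>j<n. neighbour_weight n k (int j + - int i)) = (\<Sum>d<n. neighbour_weight n k (int d))" for i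
    by (rule sum_periodic_shift) (rule neighbour_weight_periodic)
  have "(circulant_adj n k *\<^sub>v vec n (\<lambda>_. 1)) $ i = (\<Sum>d<n. neighbour_weight n k (int d))" if "i < n" for i
    unfolding shift[of i, symmetric] using that
    by (simp add: circulant_adj_eq scalar_prod_def atLeast0LessThan)
  then show ?thesis
    unfolding laplacian_def by (intro eq_matI) (auto simp: circulant_adj_eq mat_diag_def Let_def)
qed

lemma cos_periodic_int:
  assumes "n > 0"
  shows "cos (2 * pi * real p * real_of_int (d + int n) / real n)
    = cos (2 * pi * real p * real_of_int d / real n)"
  using arg_cong[OF cis_periodic[OF assms, of p d], of Re] by simp

lemma char_poly_laplacian_circulant_adj:
  assumes n: "2 * k + 1 \<le> n"
  shows "char_poly (laplacian (circulant_adj n k)) = (\<Prod>p<n. [:- circulant_eigenvalue n k p, 1:])"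
proof -
  have "(\<Sum>d<n. neighbour_weight n k (int d) * (1 - cos (2 * pi * real p * real d / real n)))
      = circulant_eigenvalue n k p" for p
  proof -
    define h where "h d = 1 - cos (2 * pi * real p * real_of_int d / real n)" for d
    have "(\<Sum>d<n. neighbour_weight n k (int d) * h (int d)) = 2 * (\<Sum>d=1..k. h (int d))"
    proof (rule sum_neighbour_weight[OF n])
      show "h (d + int n) = h d" for d
        unfolding h_def by (subst cos_periodic_int) (use n in auto)
    qed (simp add: h_def)
    then show ?thesis by (simp add: h_def circulant_eigenvalue_def)
  qed
  then show ?thesis
    unfolding laplacian_circulant_adj
    by (subst char_poly_circulant_laplacian)
      (simp_all add: neighbour_weight_periodic neighbour_weight_even)
qed

section \<open>From Fourier frequencies to ordered eigenvalues\<close>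

lemma proots_prod_linear:
  fixes f :: "nat \<Rightarrow> real"
  shows "proots (\<Prod>p<n. [:- f p, 1:]) = mset (map f [0..<n])"
proof (induction n)
  case (Suc n)
  have "(\<Prod>p<n. [:- f p, 1:]) \<noteq> 0" by auto
  then show ?case using Suc by (simp add: proots_mult del: mult_pCons_right mult_pCons_left)
qed auto

lemma sort_Cons_le: "(\<And>x. x \<in> set xs \<Longrightarrow> a \<le> x) \<Longrightarrow> sort (a # xs) = a # sort xs"
  by (simp add: insort_is_Cons)

lemma sorted_nth_length_eq_Max:
  assumes "sorted xs" "x \<in> set xs" "\<And>y. y \<in> set xs \<Longrightarrow> y \<le> x"
  shows "xs ! (length xs - 1) = x"
proof -
  obtain i where i: "i < length xs" "xs ! i = x" using assms by (auto simp: in_set_conv_nth)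
  have "x \<le> xs ! (length xs - 1)" using i assms by (auto intro!: sorted_nth_mono)
  moreover have "xs ! (length xs - 1) \<le> x" using i assms by auto
  ultimately show ?thesis by simp
qed

lemma circulant_eigenvalue_0 [simp]: "circulant_eigenvalue n k 0 = 0"
  by (simp add: circulant_eigenvalue_def)

lemma circulant_eigenvalue_nonneg: "circulant_eigenvalue n k p \<ge> 0"
  by (auto simp: circulant_eigenvalue_def intro!: sum_nonneg)

lemma ith_eigenvalue_laplacian:
  assumes "2 * k + 1 \<le> n"
  shows "ith_eigenvalue i (laplacian (circulant_adj n k)) = sort (map (circulant_eigenvalue n k) [0..<n]) ! (i - 1)"
  unfolding ith_eigenvalue_def char_poly_laplacian_circulant_adj[OF assms] proots_prod_linear
    sorted_list_of_multiset_mset by (rule refl)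

text \<open>Frequency 0 contributes the value 0, which sorts first because all values are
  nonnegative; the hypothesis \<open>min\<close> then puts frequency 1 second.\<close>

lemma ith_eigenvalue_2_laplacian:
  assumes "2 * k + 1 \<le> n" "2 \<le> n"
    and min: "\<And>p. 1 \<le> p \<Longrightarrow> p < n \<Longrightarrow> circulant_eigenvalue n k 1 \<le> circulant_eigenvalue n k p"
  shows "ith_eigenvalue 2 (laplacian (circulant_adj n k)) = circulant_eigenvalue n k 1"
proof -
  have "[0..<n] = 0 # 1 # [2..<n]" using assms(2) by (simp add: upt_conv_Cons numeral_2_eq_2)
  then have "sort (map (circulant_eigenvalue n k) [0..<n]) =
      sort (circulant_eigenvalue n k 0 # circulant_eigenvalue n k 1 # map (circulant_eigenvalue n k) [2..<n])"
    by simp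
  also have "\<dots> = circulant_eigenvalue n k 0 # sort (circulant_eigenvalue n k 1 # map (circulant_eigenvalue n k) [2..<n])"
    by (rule sort_Cons_le) (auto simp: circulant_eigenvalue_nonneg)
  also have "sort (circulant_eigenvalue n k 1 # map (circulant_eigenvalue n k) [2..<n]) =
      circulant_eigenvalue n k 1 # sort (map (circulant_eigenvalue n k) [2..<n])"
    by (rule sort_Cons_le) (auto intro!: min simp del: One_nat_def)
  finally show ?thesis using ith_eigenvalue_laplacian[OF assms(1), of 2] by simp
qed

lemma ith_eigenvalue_n_laplacian:
  assumes "2 * k + 1 \<le> n" "q < n"
    and max: "\<And>p. p < n \<Longrightarrow> circulant_eigenvalue n k p \<le> circulant_eigenvalue n k q"
  shows "ith_eigenvalue n (laplacian (circulant_adj n k)) = circulant_eigenvalue n k q"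
proof -
  have "\<And>y. y \<in> circulant_eigenvalue n k ` {0..<n} \<Longrightarrow> y \<le> circulant_eigenvalue n k q"
    using max by auto
  then show ?thesis
  using sorted_nth_length_eq_Max[of "sort (map (circulant_eigenvalue n k) [0..<n])" "circulant_eigenvalue n k q"]
    ith_eigenvalue_laplacian[OF assms(1), of n] assms(2)
  by auto
qed

section \<open>The twisted state and its Jacobian\<close>

lemma jacobian_kuramoto:
  assumes "dim_row A = n" "\<theta> \<in> carrier_vec n"
  shows "Defs.jacobian n (kuramoto_field K A) \<theta> = mat n n (\<lambda>(i, j). K * (A $$ (i, j) * cos (\<theta> $ j - \<theta> $ i)
    - (if i = j then \<Sum>l<n. A $$ (i, l) * cos (\<theta> $ l - \<theta> $ i) else 0)))"
proof (rule eq_matI)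
  fix i j assume "i < dim_row (mat n n (\<lambda>(i, j). K * (A $$ (i, j) * cos (\<theta> $ j - \<theta> $ i)
    - (if i = j then \<Sum>l<n. A $$ (i, l) * cos (\<theta> $ l - \<theta> $ i) else 0))))"
    "j < dim_col (mat n n (\<lambda>(i, j). K * (A $$ (i, j) * cos (\<theta> $ j - \<theta> $ i)
    - (if i = j then \<Sum>l<n. A $$ (i, l) * cos (\<theta> $ l - \<theta> $ i) else 0))))"
  then have ij: "i < n" "j < n" by auto
  \<comment> \<open>A Kronecker delta, so that diagonal and off-diagonal entries come from one and
    the same derivative.\<close>
  define u where "u l = (if l = j then 1 else 0 :: real)" for l
  have eq: "(\<lambda>t. kuramoto_field K A (\<theta> + t \<cdot>\<^sub>v unit_vec n j) $ i)
      = (\<lambda>t. K * (\<Sum>l<n. A $$ (i, l) * sin ((\<theta> $ l + t * u l) - (\<theta> $ i + t * u i))))"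
    using assms ij by (auto simp: kuramoto_field_def unit_vec_def u_def intro!: ext sum.cong)
  have "((\<lambda>t. K * (\<Sum>l<n. A $$ (i, l) * sin ((\<theta> $ l + t * u l) - (\<theta> $ i + t * u i)))) has_real_derivative
      K * (\<Sum>l<n. A $$ (i, l) * (cos (\<theta> $ l - \<theta> $ i) * (u l - u i)))) (at 0)"
    by (auto intro!: derivative_eq_intros sum.cong)
  then have "deriv (\<lambda>t. kuramoto_field K A (\<theta> + t \<cdot>\<^sub>v unit_vec n j) $ i) 0
      = K * (\<Sum>l<n. A $$ (i, l) * (cos (\<theta> $ l - \<theta> $ i) * (u l - u i)))"
    unfolding eq by (rule DERIV_imp_deriv)
  also have "(\<Sum>l<n. A $$ (i, l) * (cos (\<theta> $ l - \<theta> $ i) * (u l - u i)))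
      = (\<Sum>l<n. (if l = j then A $$ (i, l) * cos (\<theta> $ l - \<theta> $ i) else 0))
        - (\<Sum>l<n. A $$ (i, l) * cos (\<theta> $ l - \<theta> $ i)) * u i"
    unfolding sum_distrib_right sum_subtractf[symmetric]
    by (rule sum.cong) (auto simp: u_def algebra_simps)
  also have "\<dots> = A $$ (i, j) * cos (\<theta> $ j - \<theta> $ i)
      - (if i = j then \<Sum>l<n. A $$ (i, l) * cos (\<theta> $ l - \<theta> $ i) else 0)"
    using ij by (simp add: u_def)
  finally show "Defs.jacobian n (kuramoto_field K A) \<theta> $$ (i, j) =
      mat n n (\<lambda>(i, j). K * (A $$ (i, j) * cos (\<theta> $ j - \<theta> $ i)
    - (if i = j then \<Sum>l<n. A $$ (i, l) * cos (\<theta> $ l - \<theta> $ i) else 0))) $$ (i, j)"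
    using ij by (simp add: Defs.jacobian_def)
qed (auto simp: Defs.jacobian_def)

definition twisted_state :: "nat \<Rightarrow> real vec" where
  "twisted_state n = vec n (\<lambda>i. 2 * pi * real i / real n)"

text \<open>The factor \<open>real 1\<close> is kept so that the right-hand side matches the
  frequency pattern of \<open>cis_periodic\<close> and \<open>cos_periodic_int\<close>.\<close>

lemma twisted_state_diff:
  "i < n \<Longrightarrow> j < n \<Longrightarrow>
    twisted_state n $ j - twisted_state n $ i = 2 * pi * real 1 * real_of_int (int j - int i) / real n"
  by (simp add: twisted_state_def right_diff_distrib diff_divide_distrib)

text \<open>The force on each vertex is a shifted full-period sum of an even weight times a sine, so
  it vanishes by oddness.\<close>

lemma equilibrium_twisted_state: "equilibrium K (circulant_adj n k) (twisted_state n)"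
proof -
  have "(\<Sum>j<n. circulant_adj n k $$ (i, j) * sin (twisted_state n $ j - twisted_state n $ i)) = 0"
    if i: "i < n" for i
  proof -
    define g where "g d = neighbour_weight n k d * sin (2 * pi * real 1 * real_of_int d / real n)" for d
    have per: "g (d + int n) = g d" for d
      unfolding g_def neighbour_weight_periodic using arg_cong[OF cis_periodic[of n 1 d], of Im] i by simp
    have "(\<Sum>j<n. circulant_adj n k $$ (i, j) * sin (twisted_state n $ j - twisted_state n $ i))
        = (\<Sum>j<n. g (int j + - int i))"
      using i by (intro sum.cong) (auto simp: circulant_adj_eq g_def twisted_state_diff)
    also have "\<dots> = (\<Sum>j<n. g (int j))" by (rule sum_periodic_shift) (rule per)
    also have "\<dots> = 0" by (rule sum_odd_periodic) (simp_all only: per, simp add: g_def neighbour_weight_even)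
    finally show ?thesis .
  qed
  then show ?thesis
    unfolding equilibrium_def kuramoto_field_def
    by (auto simp: circulant_adj_def twisted_state_def intro!: eq_vecI)
qed

text \<open>The first two angles differ by \<open>2 * pi / n\<close>; congruence modulo
  \<open>2 * pi\<close> would make \<open>n\<close> divide 1.\<close>

lemma unsynchronized_twisted_state:
  assumes "n \<ge> 2"
  shows "unsynchronized (twisted_state n)"
proof -
  have "\<not> [twisted_state n $ 1 = twisted_state n $ 0] (rmod (2 * pi))"
  proof
    assume "[twisted_state n $ 1 = twisted_state n $ 0] (rmod (2 * pi))"
    then obtain l :: int where "0 = 2 * pi / real n + of_int l * (2 * pi)"
      using assms by (auto simp: rcong_altdef twisted_state_def)
    moreover define m where "m = - l"
    ultimately have "2 * pi / real n = of_int m * (2 * pi)" by simp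
    then have "2 * pi = 2 * pi * (of_int m * real n)" using assms by (simp add: field_simps)
    then have "1 = of_int m * real n" by simp
    then have "real_of_int 1 = real_of_int (m * int n)" by simp
    then have "1 = m * int n" by (simp only: of_int_eq_iff)
    then have "int n dvd 1" by (metis dvd_triv_right)
    then show False using assms by simp
  qed
  moreover have "dim_vec (twisted_state n) = n" by (simp add: twisted_state_def)
  ultimately show ?thesis
    unfolding unsynchronized_def using assms by (intro notI) (drule spec[of _ 1], drule mp, simp, drule spec[of _ 0], simp)
qed

text \<open>Phase differences depend only on \<open>j - i\<close>, so the Jacobian is again
  circulant; the minus sign in the weight puts it in the Laplacian form of
  \<open>char_poly_circulant_laplacian\<close>.\<close>

lemma jacobian_twisted_state:
  "Defs.jacobian n (kuramoto_field K (circulant_adj n k)) (twisted_state n) =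
    (let w = \<lambda>d. - K * neighbour_weight n k d * cos (2 * pi * real 1 * real_of_int d / real n) in
      mat n n (\<lambda>(i, j). (if i = j then \<Sum>d<n. w (int d) else 0) - w (int j - int i)))"
proof -
  define g where "g d = neighbour_weight n k d * cos (2 * pi * real 1 * real_of_int d / real n)" for d
  have dims: "dim_row (circulant_adj n k) = n" "twisted_state n \<in> carrier_vec n"
    by (auto simp: circulant_adj_def twisted_state_def)
  have "(\<Sum>l<n. circulant_adj n k $$ (i, l) * cos (twisted_state n $ l - twisted_state n $ i)) =
      (\<Sum>d<n. g (int d))" if i: "i < n" for i
  proof -
    have "(\<Sum>l<n. circulant_adj n k $$ (i, l) * cos (twisted_state n $ l - twisted_state n $ i))
        = (\<Sum>j<n. g (int j + - int i))"
      using i by (intro sum.cong) (auto simp: circulant_adj_eq g_def twisted_state_diff)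
    also have "\<dots> = (\<Sum>j<n. g (int j))"
      by (rule sum_periodic_shift)
        (unfold g_def neighbour_weight_periodic, use cos_periodic_int[of n 1] i in simp)
    finally show ?thesis .
  qed
  moreover have "circulant_adj n k $$ (i, j) * cos (twisted_state n $ j - twisted_state n $ i)
      = g (int j - int i)" if "i < n" "j < n" for i j
    using that by (simp add: circulant_adj_eq g_def twisted_state_diff)
  moreover have w: "(\<lambda>d. - K * neighbour_weight n k d * cos (2 * pi * real 1 * real_of_int d / real n)) =
      (\<lambda>d. - K * g d)"
    by (simp add: g_def mult.assoc)
  ultimately show ?thesis
    unfolding Let_def w jacobian_kuramoto[OF dims]
    by (intro eq_matI) (simp_all add: sum_distrib_left[symmetric] sum_negf right_diff_distrib)
qed

text \<open>The Jacobian eigenvalue at frequency \<open>p\<close> is \<open>- 2 * K\<close> times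
  the sum in \<open>pos\<close>. Hence all frequencies from 1 to \<open>n - 1\<close> give negative
  values, and the root 0 comes from frequency 0 alone, with multiplicity one.\<close>

lemma stable_twisted_state:
  assumes K: "K > 0" and n: "2 * k + 1 \<le> n" "n \<ge> 2"
    and pos: "\<And>p. 1 \<le> p \<Longrightarrow> p < n \<Longrightarrow>
      (\<Sum>d=1..k. cos (2 * pi * real d / real n) * (1 - cos (2 * pi * real p * real d / real n))) > 0"
  shows "stable_equilibrium K (circulant_adj n k) (twisted_state n)"
proof -
  define J where "J = Defs.jacobian n (kuramoto_field K (circulant_adj n k)) (twisted_state n)"
  define w where "w d = - K * neighbour_weight n k d * cos (2 * pi * real 1 * real_of_int d / real n)" for d
  define \<nu> where "\<nu> p = (\<Sum>d<n. w (int d) * (1 - cos (2 * pi * real p * real d / real n)))" for p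
  have J: "J = mat n n (\<lambda>(i, j). (if i = j then \<Sum>d<n. w (int d) else 0) - w (int j - int i))"
    unfolding J_def jacobian_twisted_state w_def Let_def ..
  have w_per: "w (d + int n) = w d" for d
    using cos_periodic_int[of n 1 d] n unfolding w_def neighbour_weight_periodic by simp
  have w_even: "w (- d) = w d" for d
    by (simp add: w_def neighbour_weight_even)
  have char_poly: "char_poly J = (\<Prod>p<n. [:- \<nu> p, 1:])"
    unfolding J \<nu>_def using w_per w_even by (rule char_poly_circulant_laplacian)
  have \<nu>: "\<nu> p = - K * (2 * (\<Sum>d=1..k. cos (2 * pi * real d / real n) * (1 - cos (2 * pi * real p * real d / real n))))"
    for p
  proof -
    define h where "h d = cos (2 * pi * real 1 * real_of_int d / real n) *
      (1 - cos (2 * pi * real p * real_of_int d / real n))" for d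
    have "\<nu> p = - K * (\<Sum>d<n. neighbour_weight n k (int d) * h (int d))"
      unfolding \<nu>_def sum_distrib_left by (rule sum.cong) (simp_all add: w_def h_def)
    also have "(\<Sum>d<n. neighbour_weight n k (int d) * h (int d)) = 2 * (\<Sum>d=1..k. h (int d))"
    proof (rule sum_neighbour_weight[OF n(1)])
      show "h (d + int n) = h d" for d
        unfolding h_def using cos_periodic_int[of n 1 d] cos_periodic_int[of n p d] n by simp
      show "h (- d) = h d" for d by (simp add: h_def)
    qed
    finally show ?thesis by (simp add: h_def)
  qed
  have \<nu>0: "\<nu> 0 = 0" by (simp add: \<nu>_def)
  have \<nu>_neg: "\<nu> p < 0" if "1 \<le> p" "p < n" for p
    using pos[OF that] K unfolding \<nu> by simp
  have eigenvector: "eigenvector J (vec n (\<lambda>_. 1)) 0"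
  proof -
    have "(\<Sum>j<n. w (int j - int i)) = (\<Sum>d<n. w (int d))" for i
      using sum_periodic_shift[of w n "- int i"] w_per by simp
    then have "J *\<^sub>v vec n (\<lambda>_. 1) = 0 \<cdot>\<^sub>v vec n (\<lambda>_. 1)"
      by (intro eq_vecI) (auto simp: J scalar_prod_def atLeast0LessThan sum_subtractf)
    moreover have "vec n (\<lambda>_. 1) \<noteq> (0\<^sub>v n :: real vec)"
    proof
      assume "vec n (\<lambda>_. 1) = (0\<^sub>v n :: real vec)"
      then have "vec n (\<lambda>_. 1) $ 0 = (0\<^sub>v n :: real vec) $ 0" by simp
      then show False using n by simp
    qed
    ultimately show ?thesis unfolding eigenvector_def by (simp add: J)
  qed
  have "order 0 (char_poly J) = count (proots (char_poly J)) 0"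
    using n by (subst count_proots) (auto simp: char_poly)
  also have "\<dots> = count (mset (map \<nu> [0..<n])) 0"
    unfolding char_poly proots_prod_linear ..
  also have "[0..<n] = 0 # [1..<n]" using n by (simp add: upt_conv_Cons)
  also have "count (mset (map \<nu> (0 # [1..<n]))) 0 = Suc (count (mset (map \<nu> [1..<n])) 0)"
    by (simp add: \<nu>0)
  also have "count (mset (map \<nu> [1..<n])) 0 = 0"
    unfolding count_eq_zero_iff using \<nu>_neg by force
  finally have order: "order 0 (char_poly J) = 1" by simp
  have "x < 0" if "eigenvalue J x" "x \<noteq> 0" for x
  proof -
    have "poly (char_poly J) x = 0"
      using eigenvalue_root_char_poly[of J n] that by (simp add: J)
    then obtain p where "p < n" "x = \<nu> p"
      unfolding char_poly poly_prod by (auto simp: prod_zero_iff)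
    then show ?thesis using \<nu>0 \<nu>_neg[of p] that by (cases "p = 0") auto
  qed
  moreover have "dim_row (circulant_adj n k) = n" by (simp add: circulant_adj_def)
  ultimately show ?thesis
    unfolding stable_equilibrium_def Let_def
    using equilibrium_twisted_state eigenvector order J_def by simp
qed

section \<open>Extremal frequencies\<close>

text \<open>Both sides vanish at 0, and the difference has derivative
  \<open>M * (1 / (cos (M * t))\<^sup>2 - 1 / (cos t)\<^sup>2)\<close>, which is positive because
  cosine decreases.\<close>

lemma tan_mult_less:
  fixes M x :: real
  assumes "M > 1" "0 < x" "M * x < pi / 2"
  shows "M * tan x < tan (M * x)"
proof -
  have cos_pos: "cos (M * t) > 0" "cos t > 0" if "0 \<le> t" "t \<le> x" for t
  proof -
    have "1 * t \<le> M * t" "M * t \<le> M * x"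
      using that assms by (intro mult_right_mono mult_left_mono; simp)+
    then have "- (pi / 2) < M * t" "M * t < pi / 2" "- (pi / 2) < t" "t < pi / 2"
      using assms that pi_gt_zero by linarith+
    then show "cos (M * t) > 0" "cos t > 0" by (auto intro: cos_gt_zero_pi)
  qed
  have "\<exists>l z. 0 < z \<and> z < x \<and> DERIV (\<lambda>t. tan (M * t) - M * tan t) z :> l \<and>
      (tan (M * x) - M * tan x) - (tan (M * 0) - M * tan 0) = (x - 0) * l"
  proof (rule MVT)
    show "0 < x" by fact
    show "continuous_on {0..x} (\<lambda>t. tan (M * t) - M * tan t)"
      by (intro continuous_intros ballI; use cos_pos in force)
    fix t assume "0 < t" "t < x"
    then show "(\<lambda>t. tan (M * t) - M * tan t) differentiable (at t)"
      using cos_pos[of t] unfolding real_differentiable_def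
      by (intro exI) (auto intro!: derivative_eq_intros)
  qed
  then obtain l z where z: "0 < z" "z < x" and D: "DERIV (\<lambda>t. tan (M * t) - M * tan t) z :> l"
    and eq: "tan (M * x) - M * tan x = x * l" by auto
  have zM: "z < M * z" "M * z < M * x" using z assms by auto
  have c: "cos (M * z) > 0" "cos z > 0" using cos_pos[of z] z by auto
  have "DERIV (\<lambda>t. tan (M * t) - M * tan t) z :> M * inverse ((cos (M * z))\<^sup>2) - M * inverse ((cos z)\<^sup>2)"
    using c by (auto intro!: derivative_eq_intros)
  then have l: "l = M * (inverse ((cos (M * z))\<^sup>2) - inverse ((cos z)\<^sup>2))"
    using D DERIV_unique by (fastforce simp: algebra_simps)
  have "cos (M * z) < cos z" using z zM assms pi_gt_zero by (intro cos_monotone_0_pi) linarith+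
  then have "(cos (M * z))\<^sup>2 < (cos z)\<^sup>2" using c by (intro power_strict_mono) auto
  then have "inverse ((cos z)\<^sup>2) < inverse ((cos (M * z))\<^sup>2)" using c by (intro less_imp_inverse_less) auto
  then have "l > 0" unfolding l using assms by simp
  then show ?thesis using eq \<open>0 < x\<close> mult_pos_pos[of x l] by linarith
qed

text \<open>The numerator of the derivative is negative exactly by \<open>tan_mult_less\<close>. A
  derivative is needed only in the open interval, which allows the endpoint
  \<open>M * y = pi / 2\<close>, a pole of the tangent.\<close>

lemma sin_ratio_strict_antimono:
  fixes M x y :: real
  assumes M: "M > 1" and xy: "0 < x" "x < y" and y: "M * y \<le> pi / 2"
  shows "sin (M * y) / sin y < sin (M * x) / sin x"
proof (rule DERIV_neg_imp_decreasing_open[OF xy(2)])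
  have "1 * y < M * y" using M xy by (intro mult_strict_right_mono) auto
  then have y': "y < pi / 2" using y by simp
  show "continuous_on {x..y} (\<lambda>t. sin (M * t) / sin t)"
    using xy y' by (intro continuous_intros ballI less_imp_neq[symmetric] sin_gt_zero) auto
  fix t assume t: "x < t" "t < y"
  have "M * t < M * y" using t M by (intro mult_strict_left_mono) auto
  then have Mt: "M * t < pi / 2" using y by simp
  have "0 < M * t" using t xy M by (intro mult_pos_pos) auto
  have s: "sin t > 0" "cos t > 0" "cos (M * t) > 0"
    using t xy y' Mt \<open>0 < M * t\<close> by (intro sin_gt_zero cos_gt_zero_pi; linarith)+
  have "M * tan t < tan (M * t)" using tan_mult_less[of M t] M t xy Mt by auto
  then have "M * cos (M * t) * sin t < sin (M * t) * cos t"
    using s by (simp add: tan_def field_simps)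
  then have "(M * cos (M * t) * sin t - sin (M * t) * cos t) / (sin t * sin t) < 0"
    using s by (intro divide_neg_pos) auto
  moreover have "DERIV (\<lambda>t. sin (M * t) / sin t) t :>
      (M * cos (M * t) * sin t - sin (M * t) * cos t) / (sin t * sin t)"
    using s by (auto intro!: derivative_eq_intros)
  ultimately show "\<exists>l. DERIV (\<lambda>t. sin (M * t) / sin t) t :> l \<and> l < 0"
    by blast
qed

text \<open>Up to the first peak of \<open>sin (M * t)\<close> the ratio decreases. Beyond the peak
  the numerator is at most 1 and \<open>sin y\<close> exceeds its value at the peak, so the ratio
  stays below the one attained there.\<close>

lemma sin_ratio_less:
  fixes M x y :: real
  assumes M: "M > 1" and xy: "0 < x" "x < y" "y \<le> pi / 2" and x: "M * x \<le> pi / 2"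
  shows "\<bar>sin (M * y)\<bar> / sin y < sin (M * x) / sin x"
proof (cases "M * y \<le> pi / 2")
  case True
  have "sin (M * y) \<ge> 0" using True M xy by (intro sin_ge_zero) auto
  then show ?thesis using sin_ratio_strict_antimono[OF M xy(1,2) True] by simp
next
  case False
  \<comment> \<open>The point where \<open>sin (M * t)\<close> first reaches 1.\<close>
  define z where "z = pi / (2 * M)"
  have z: "M * z = pi / 2" "x \<le> z" "z < y" "0 < z"
    using M x False by (auto simp: z_def field_simps)
  have "sin z < sin y" using z xy by (intro sin_monotone_2pi) auto
  moreover have "sin z > 0" using z xy by (intro sin_gt_zero) auto
  ultimately have "1 / sin y < 1 / sin z" "sin y > 0" by (auto intro: divide_strict_left_mono)
  moreover from \<open>sin y > 0\<close> have "\<bar>sin (M * y)\<bar> / sin y \<le> 1 / sin y"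
    by (intro divide_right_mono) auto
  ultimately have "\<bar>sin (M * y)\<bar> / sin y < 1 / sin z" by linarith
  also have "\<dots> = sin (M * z) / sin z" unfolding z(1) by simp
  also have "\<dots> \<le> sin (M * x) / sin x"
    using sin_ratio_strict_antimono[OF M xy(1) _ eq_refl[OF z(1)]] z(2)
    by (cases "x = z") (simp, fastforce intro: less_imp_le)
  finally show ?thesis .
qed

text \<open>Adds the degenerate multipliers 0 and 1. In the applications \<open>M\<close> is a
  natural number, so no value strictly between 0 and 1 arises.\<close>

lemma sin_ratio_le:
  fixes M x y :: real
  assumes M: "M = 0 \<or> M \<ge> 1" and xy: "0 < x" "x \<le> y" "y \<le> pi / 2" and x: "M * x \<le> pi / 2"
  shows "\<bar>sin (M * y)\<bar> / sin y \<le> sin (M * x) / sin x"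
proof -
  consider "M = 0" | "M = 1" | "x = y" "M > 1" | "M > 1" "x < y" using M xy by linarith
  then show ?thesis
  proof cases
    case 2
    then show ?thesis using xy sin_gt_zero[of x] sin_gt_zero[of y] by simp
  next
    case 3
    then have "sin (M * y) \<ge> 0" using x xy by (intro sin_ge_zero) auto
    then show ?thesis using 3 by simp
  next
    case 4
    then show ?thesis using sin_ratio_less[OF 4(1) xy(1) 4(2) xy(3) x] by simp
  qed simp
qed

section \<open>Closed form of the eigenvalues and the complementary angle\<close>

lemma sin_times_dirichlet_kernel:
  fixes x :: real
  shows "sin x * (1 + 2 * (\<Sum>d=1..k. cos (2 * real d * x))) = sin (real (2 * k + 1) * x)"
proof (induction k)
  case (Suc k)
  \<comment> \<open>Product-to-sum: each added cosine term is a difference of consecutive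
    odd-multiple sines, so the sum telescopes.\<close>
  have "2 * sin x * cos (2 * real (Suc k) * x) = sin (real (2 * Suc k + 1) * x) - sin (real (2 * k + 1) * x)"
  proof -
    have "sin (2 * real (Suc k) * x + x) - sin (2 * real (Suc k) * x - x) = 2 * sin x * cos (2 * real (Suc k) * x)"
      by (simp only: sin_add sin_diff) simp
    moreover have "2 * real (Suc k) * x + x = real (2 * Suc k + 1) * x" "2 * real (Suc k) * x - x = real (2 * k + 1) * x"
      by (simp_all add: algebra_simps)
    ultimately show ?thesis by simp
  qed
  then show ?case using Suc by (simp add: algebra_simps)
qed simp

lemma pi_fraction_bounds:
  assumes "1 \<le> p" "p < n"
  shows "0 < real p * (pi / real n)" "real p * (pi / real n) < pi" "sin (real p * (pi / real n)) > 0"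
proof -
  show 1: "0 < real p * (pi / real n)" using assms by simp
  show 2: "real p * (pi / real n) < pi" using assms by (simp add: field_simps)
  show "sin (real p * (pi / real n)) > 0" using 1 2 by (rule sin_gt_zero)
qed

lemma circulant_eigenvalue_closed:
  assumes "1 \<le> p" "p < n"
  shows "circulant_eigenvalue n k p = real (2 * k + 1)
    - sin (real (2 * k + 1) * (real p * (pi / real n))) / sin (real p * (pi / real n))"
proof -
  define x where "x = real p * (pi / real n)"
  have "sin x > 0" unfolding x_def by (rule pi_fraction_bounds[OF assms])
  then have "sin (real (2 * k + 1) * x) / sin x = 1 + 2 * (\<Sum>d=1..k. cos (2 * real d * x))"
    unfolding sin_times_dirichlet_kernel[symmetric] by simp
  moreover have "circulant_eigenvalue n k p = 2 * real k - 2 * (\<Sum>d=1..k. cos (2 * real d * x))"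
    unfolding circulant_eigenvalue_def sum_subtractf
    by (simp add: x_def algebra_simps)
  ultimately show ?thesis unfolding x_def by simp
qed

text \<open>Conjugate Fourier modes share an eigenvalue, so only frequencies up to
  \<open>n / 2\<close> have to be examined.\<close>

lemma circulant_eigenvalue_reflect:
  assumes "p \<le> n" "n > 0"
  shows "circulant_eigenvalue n k (n - p) = circulant_eigenvalue n k p"
proof -
  have "cos (2 * pi * real (n - p) * real d / real n) = cos (2 * pi * real p * real d / real n)" for d
  proof -
    have "2 * pi * real (n - p) * real d / real n = 2 * pi * real d - 2 * pi * real p * real d / real n"
      using assms by (simp add: of_nat_diff field_simps)
    moreover have "cos (2 * pi * real d) = 1" "sin (2 * pi * real d) = 0"
      using cos_2npi[of d] sin_2npi[of d] by (simp_all add: mult_ac)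
    ultimately show ?thesis by (simp add: cos_diff)
  qed
  then show ?thesis by (simp add: circulant_eigenvalue_def)
qed

text \<open>Since \<open>2 * k + 1 + m = n\<close>, the two angles add up to \<open>p * pi\<close>.
  Here \<open>m\<close> is the number of non-neighbours of a vertex, which is small at high
  density.\<close>

lemma sin_complement:
  assumes n: "2 * k + 1 \<le> n" and m: "m = n - (2 * k + 1)" and p: "1 \<le> p" "p < n"
  shows "sin (real (2 * k + 1) * (real p * (pi / real n))) = - ((- 1) ^ p) * sin (real m * (real p * (pi / real n)))"
proof -
  have "real (2 * k + 1) * (real p * (pi / real n)) = real p * pi - real m * (real p * (pi / real n))"
    using p n unfolding m of_nat_diff[OF n] by (simp add: field_simps)
  then show ?thesis by (simp add: sin_diff sin_npi cos_npi)
qed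

lemma abs_sin_complement:
  assumes "2 * k + 1 \<le> n" "m = n - (2 * k + 1)" "1 \<le> p" "p < n"
  shows "\<bar>sin (real (2 * k + 1) * (real p * (pi / real n)))\<bar> = \<bar>sin (real m * (real p * (pi / real n)))\<bar>"
  unfolding sin_complement[OF assms] by (simp add: abs_mult power_abs)

text \<open>The sine ratio is applied with multiplier \<open>2 * k + 1\<close> or \<open>m\<close>,
  whichever makes the angle at frequency 1 at most \<open>pi / 2\<close>. At frequency 1 the two
  sines agree; at frequency \<open>p\<close> they agree up to sign, which the absolute value
  absorbs. Strictness needs a multiplier above 1, whence \<open>k \<ge> 1\<close> and
  \<open>2 * k + 3 \<le> n\<close>.\<close>

lemma circulant_eigenvalue_1_le_half:
  assumes n: "2 * k + 1 \<le> n" and p: "1 \<le> p" "2 * p \<le> n" "n \<ge> 2"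
  shows "circulant_eigenvalue n k 1 \<le> circulant_eigenvalue n k p"
    and "k \<ge> 1 \<Longrightarrow> 2 * k + 3 \<le> n \<Longrightarrow> 2 \<le> p \<Longrightarrow> circulant_eigenvalue n k 1 < circulant_eigenvalue n k p"
proof -
  define h where "h = pi / real n"
  define m where "m = n - (2 * k + 1)"
  have pn: "p < n" using p by auto
  have h: "0 < h" "h \<le> real p * h" "real p * h \<le> pi / 2"
    using p by (auto simp: h_def field_simps)
  have s: "sin (real p * h) > 0" unfolding h_def using p(1) pn by (rule pi_fraction_bounds)
  have s1: "sin h > 0" using h pi_gt_zero by (intro sin_gt_zero) linarith+
  have sum: "real (2 * k + 1) * h + real m * h = pi"
    using n p unfolding h_def m_def of_nat_diff[OF n] by (simp add: field_simps)
  have goal_iff: "circulant_eigenvalue n k p - circulant_eigenvalue n k 1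
      = sin (real (2 * k + 1) * h) / sin h - sin (real (2 * k + 1) * (real p * h)) / sin (real p * h)"
    using circulant_eigenvalue_closed[of 1 n k] circulant_eigenvalue_closed[OF p(1) pn, of k] p
    by (simp add: h_def)
  have le_abs: "sin (real (2 * k + 1) * (real p * h)) / sin (real p * h)
      \<le> \<bar>sin (real (2 * k + 1) * (real p * h))\<bar> / sin (real p * h)"
    using s by (intro divide_right_mono) auto
  have compl_p: "\<bar>sin (real (2 * k + 1) * (real p * h))\<bar> = \<bar>sin (real m * (real p * h))\<bar>"
    unfolding h_def using n m_def p(1) pn by (rule abs_sin_complement)
  have compl_1: "sin (real (2 * k + 1) * h) = sin (real m * h)"
    using sin_complement[OF n m_def, of 1] p by (simp add: h_def)
  consider "real (2 * k + 1) * h \<le> pi / 2" | "real m * h \<le> pi / 2" using sum by linarith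
  note half = this
  show "circulant_eigenvalue n k 1 \<le> circulant_eigenvalue n k p"
  proof (cases rule: half)
    case 1
    then show ?thesis using sin_ratio_le[OF _ h 1] le_abs goal_iff by linarith
  next
    case 2
    have "real m = 0 \<or> real m \<ge> 1" by auto
    then show ?thesis using sin_ratio_le[OF _ h 2] le_abs goal_iff compl_p compl_1 by simp
  qed
  assume k: "k \<ge> 1" "2 * k + 3 \<le> n" "2 \<le> p"
  then have M: "real (2 * k + 1) > 1" "real m > 1" by (auto simp: m_def)
  have h2: "h < real p * h" using k h by simp
  show "circulant_eigenvalue n k 1 < circulant_eigenvalue n k p"
  proof (cases rule: half)
    case 1
    then show ?thesis using sin_ratio_less[OF M(1) h(1) h2 h(3) 1] le_abs goal_iff by linarith
  next
    case 2
    then show ?thesis using sin_ratio_less[OF M(2) h(1) h2 h(3) 2] le_abs goal_iff compl_p compl_1 by simp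
  qed
qed

lemma circulant_eigenvalue_1_le:
  assumes "2 * k + 1 \<le> n" "1 \<le> p" "p < n"
  shows "circulant_eigenvalue n k 1 \<le> circulant_eigenvalue n k p"
proof (cases "2 * p \<le> n")
  case True
  then show ?thesis using circulant_eigenvalue_1_le_half(1)[of k n p] assms by auto
next
  case False
  then have "1 \<le> n - p" "2 * (n - p) \<le> n" "n \<ge> 2" using assms by auto
  then show ?thesis
    using circulant_eigenvalue_1_le_half(1)[of k n "n - p"] circulant_eigenvalue_reflect[of p n k] assms
    by auto
qed

text \<open>The bound \<open>p + 2 \<le> n\<close> excludes \<open>n - 1\<close>, the mirror image
  of frequency 1, where equality holds.\<close>

lemma circulant_eigenvalue_1_less:
  assumes "k \<ge> 1" "2 * k + 3 \<le> n" "2 \<le> p" "p + 2 \<le> n"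
  shows "circulant_eigenvalue n k 1 < circulant_eigenvalue n k p"
proof (cases "2 * p \<le> n")
  case True
  then show ?thesis using circulant_eigenvalue_1_le_half(2)[of k n p] assms by auto
next
  case False
  then have "2 \<le> n - p" "2 * (n - p) \<le> n" "n \<ge> 2" using assms by auto
  then show ?thesis
    using circulant_eigenvalue_1_le_half(2)[of k n "n - p"] circulant_eigenvalue_reflect[of p n k] assms
    by auto
qed

lemma sin_triple:
  fixes x :: real
  shows "sin (3 * x) = sin x * (4 * (cos x)\<^sup>2 - 1)"
proof -
  \<comment> \<open>The combination \<open>s\<^sup>2 + c\<^sup>2\<close> is kept intact so that the
    Pythagorean identity can rewrite it to 1.\<close>
  have ring: "2 * s * c * c + (c\<^sup>2 - s\<^sup>2) * s = s * (4 * c\<^sup>2 - (s\<^sup>2 + c\<^sup>2))" for s c :: real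
    by (simp add: power2_eq_square algebra_simps)
  have "sin (3 * x) = sin (2 * x + x)" by simp
  also have "\<dots> = sin x * (4 * (cos x)\<^sup>2 - ((sin x)\<^sup>2 + (cos x)\<^sup>2))"
    unfolding sin_add sin_double cos_double by (rule ring)
  finally show ?thesis unfolding sin_cos_squared_add .
qed

text \<open>Half-angle form of the cosine together with
  \<open>\<bar>sin y\<bar> \<le> \<bar>y\<bar>\<close>.\<close>

lemma cos_ge_quadratic:
  fixes x :: real
  assumes "x \<ge> 0"
  shows "cos x \<ge> 1 - x\<^sup>2 / 2"
proof -
  have "\<bar>sin (x / 2)\<bar> \<le> \<bar>x / 2\<bar>" by (rule abs_sin_x_le_abs_x)
  then have "(sin (x / 2))\<^sup>2 \<le> (x / 2)\<^sup>2" by (simp only: abs_le_square_iff)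
  moreover have "cos x = 1 - 2 * (sin (x / 2))\<^sup>2" using cos_double_sin[of "x / 2"] by simp
  ultimately show ?thesis by (simp add: power_divide)
qed

text \<open>
  The only frequency other than 2 that could carry the largest eigenvalue is 3, and it
  dominates frequency 2 exactly when \<open>4 cos b cos h < 1\<close>; in the limit \<open>h = 0\<close> the bound on \<open>cos b\<close>
  admits every density above about 0.59.
\<close>
lemma circulant_eigenvalue_le_2:
  assumes n: "2 * k + 1 \<le> n" "n \<ge> 20" and p: "p < n"
    and b: "cos (real (n - (2 * k + 1)) * (pi / real n)) \<ge> 28 / 100"
  shows "circulant_eigenvalue n k p \<le> circulant_eigenvalue n k 2"
proof -
  define h where "h = pi / real n"
  define m where "m = n - (2 * k + 1)"
  define b where "b = real m * h"
  \<comment> \<open>From \<open>n \<ge> 20\<close>: \<open>pi / 20\<close> is about 0.157.\<close>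
  have h: "0 < h" "h \<le> 16 / 100"
    using n pi_less_4 pi_approx by (auto simp: h_def field_simps)
  have cos_b: "cos b \<ge> 28 / 100" using b by (simp add: b_def m_def h_def)
  have "b \<ge> 0" by (simp add: b_def h less_imp_le)
  have "b \<le> pi" using n by (auto simp: b_def h_def m_def field_simps)
  have b_less: "b < pi / 2"
  proof (rule ccontr)
    assume "\<not> b < pi / 2"
    then have "cos b \<le> cos (pi / 2)" using \<open>b \<le> pi\<close> by (intro cos_monotone_0_pi_le) auto
    then show False using cos_b by simp
  qed
  have sin_b: "sin b \<ge> 0" using \<open>b \<ge> 0\<close> \<open>b \<le> pi\<close> by (rule sin_ge_zero)
  have sin_2b: "sin (2 * b) \<ge> 0" using \<open>b \<ge> 0\<close> b_less by (intro sin_ge_zero) auto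
  have "h\<^sup>2 \<le> (16 / 100)\<^sup>2" using h by (intro power_mono) auto
  then have cos_h: "cos h \<ge> 95 / 100" "cos (2 * h) \<ge> 948 / 1000"
    using cos_ge_quadratic[of h] cos_ge_quadratic[of "2 * h"] h by (auto simp: power2_eq_square)
  have sin_h: "sin h > 0" "sin (2 * h) > 0" "sin (3 * h) > 0" "sin (4 * h) > 0"
    using h pi_gt3 by (auto intro!: sin_gt_zero)
  have ev_sin: "circulant_eigenvalue n k q = real (2 * k + 1) + (- 1) ^ q * (sin (real q * b) / sin (real q * h))"
    if q: "1 \<le> q" "q < n" for q
  proof -
    have "real m * (real q * (pi / real n)) = real q * b" by (simp add: b_def h_def)
    then show ?thesis
      using circulant_eigenvalue_closed[OF q, of k] sin_complement[OF n(1) m_def q] by (simp add: h_def)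
  qed
  have ev_2: "circulant_eigenvalue n k 2 = real (2 * k + 1) + sin (2 * b) / sin (2 * h)"
    using ev_sin[of 2] n by simp
  have ev_le: "circulant_eigenvalue n k q \<le> real (2 * k + 1) + \<bar>sin (real q * b)\<bar> / sin (real q * h)"
    if q: "1 \<le> q" "2 * q \<le> n" for q
  proof -
    have "(- 1) ^ q * (sin (real q * b) / sin (real q * h)) \<le> \<bar>(- 1) ^ q * (sin (real q * b) / sin (real q * h))\<bar>"
      by (rule abs_ge_self)
    also have "\<dots> = \<bar>sin (real q * b)\<bar> / sin (real q * h)"
      using pi_fraction_bounds(3)[of q n] q by (simp add: abs_mult power_abs h_def)
    finally show ?thesis using ev_sin[of q] q by simp
  qed
  have half: "circulant_eigenvalue n k q \<le> circulant_eigenvalue n k 2" if q: "2 * q \<le> n" for q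
  proof -
    have qh: "real q * h \<le> pi / 2" using q n by (simp add: h_def field_simps)
    \<comment> \<open>For \<open>b \<le> pi / 4\<close> the sine ratio still decreases from
      \<open>2 * h\<close> on and settles every \<open>q \<ge> 2\<close>. For larger
      \<open>b\<close> only frequency 3 is delicate; from 4 on, bounding the numerator by 1
      suffices.\<close>
    consider "q = 0" | "q = 1" | "2 \<le> q" "b \<le> pi / 4" | "q = 2" | "q = 3" | "4 \<le> q" "b > pi / 4"
      by linarith
    then show ?thesis
    proof cases
      case 1
      then show ?thesis by (simp add: circulant_eigenvalue_nonneg)
    next
      case 2
      then show ?thesis
        using ev_sin[of 1] n sin_b sin_2b sin_h unfolding ev_2 by (simp add: divide_nonneg_pos order_trans[of _ 0])
    next
      case 3
      have "real m = 0 \<or> real m \<ge> 1" by auto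
      moreover have "0 < 2 * h" "2 * h \<le> real q * h" "real m * (2 * h) \<le> pi / 2"
        using 3 h by (auto simp: b_def)
      ultimately have "\<bar>sin (real m * (real q * h))\<bar> / sin (real q * h) \<le> sin (real m * (2 * h)) / sin (2 * h)"
        using qh sin_ratio_le by blast
      moreover have "real m * (real q * h) = real q * b" "real m * (2 * h) = 2 * b" by (simp_all add: b_def)
      ultimately show ?thesis using ev_le[of q] q 3 unfolding ev_2 by simp
    next
      case 5
      have "cos h > 0" "4 * (cos h)\<^sup>2 - 1 > 0"
        using cos_h power_mono[of "95 / 100" "cos h" 2] by (auto simp: power2_eq_square)
      \<comment> \<open>The product is 0.266, just above the 1/4 required. After the triple- and
        double-angle formulas, the comparison of frequencies 3 and 2 is the factored inequality that
        follows.\<close>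
      have "28 / 100 * (95 / 100) \<le> cos b * cos h" using cos_b cos_h by (intro mult_mono) auto
      then have "0 \<le> (cos h + cos b) * (4 * (cos b * cos h) - 1)"
        using cos_b cos_h by (intro mult_nonneg_nonneg) auto
      then have "(1 - 4 * (cos b)\<^sup>2) * cos h \<le> cos b * (4 * (cos h)\<^sup>2 - 1)"
        by (simp add: power2_eq_square algebra_simps)
      then have "(1 - 4 * (cos b)\<^sup>2) / (4 * (cos h)\<^sup>2 - 1) \<le> cos b / cos h"
        using \<open>cos h > 0\<close> \<open>4 * (cos h)\<^sup>2 - 1 > 0\<close> by (simp add: divide_le_eq field_simps)
      then have "sin b / sin h * ((1 - 4 * (cos b)\<^sup>2) / (4 * (cos h)\<^sup>2 - 1)) \<le> sin b / sin h * (cos b / cos h)"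
        using sin_b sin_h by (intro mult_left_mono) auto
      moreover have "sin b / sin h * ((1 - 4 * (cos b)\<^sup>2) / (4 * (cos h)\<^sup>2 - 1)) = - (sin (3 * b) / sin (3 * h))"
        unfolding sin_triple times_divide_times_eq minus_divide_left by (simp add: algebra_simps)
      moreover have "sin b / sin h * (cos b / cos h) = sin (2 * b) / sin (2 * h)"
        unfolding sin_double by simp
      ultimately show ?thesis using ev_sin[of 3] n unfolding ev_2 5 by simp
    next
      case 6
      define u where "u = (cos b)\<^sup>2"
      have "cos b \<le> cos (pi / 4)" using 6 b_less by (intro cos_monotone_0_pi_le) auto
      then have "u \<le> (cos (pi / 4))\<^sup>2" unfolding u_def using cos_b by (intro power_mono) auto
      then have "u \<le> 1 / 2" by (simp add: cos_45 power_divide)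
      moreover have "u \<ge> (28 / 100)\<^sup>2" unfolding u_def using cos_b by (intro power_mono) auto
      \<comment> \<open>The constants are \<open>(28 / 100)\<^sup>2\<close> and its complement to 1,
        so the product bounds \<open>u * (1 - u)\<close> from below by its value at the left
        endpoint.\<close>
      ultimately have "0 \<le> (u - 784 / 10000) * (9216 / 10000 - u)"
        by (intro mult_nonneg_nonneg) (auto simp: power2_eq_square)
      then have "(53 / 100)\<^sup>2 \<le> 4 * u * (1 - u)"
        unfolding power2_eq_square left_diff_distrib right_diff_distrib by linarith
      also have "\<dots> = (sin (2 * b))\<^sup>2"
        by (simp add: u_def sin_double power_mult_distrib sin_squared_eq)
      finally have "sin (2 * b) \<ge> 53 / 100" using sin_2b by (rule power2_le_imp_le)
      \<comment> \<open>The left side is just above 1/2, which is what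
        \<open>sin (4 * h) = 2 * sin (2 * h) * cos (2 * h)\<close> calls for.\<close>
      then have "53 / 100 * (948 / 1000) \<le> sin (2 * b) * cos (2 * h)"
        using cos_h by (intro mult_mono) auto
      then have "1 \<le> sin (2 * b) * (2 * cos (2 * h))" by simp
      then have "1 * sin (2 * h) \<le> sin (2 * b) * (2 * cos (2 * h)) * sin (2 * h)"
        using sin_h by (intro mult_right_mono) auto
      also have "\<dots> = sin (2 * b) * sin (4 * h)"
        using sin_double[of "2 * h"] by simp
      finally have bound: "1 / sin (4 * h) \<le> sin (2 * b) / sin (2 * h)"
        using sin_h by (simp add: field_simps)
      have "sin (4 * h) \<le> sin (real q * h)"
        using 6 qh h pi_gt_zero by (intro sin_monotone_2pi_le mult_right_mono) linarith+
      then have "\<bar>sin (real q * b)\<bar> / sin (real q * h) \<le> 1 / sin (4 * h)"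
        using sin_h by (intro frac_le) auto
      then show ?thesis using bound ev_le[of q] q 6 unfolding ev_2 by simp
    qed simp
  qed
  show ?thesis
  proof (cases "2 * p \<le> n")
    case False
    then have "2 * (n - p) \<le> n" by auto
    then show ?thesis using half[of "n - p"] circulant_eigenvalue_reflect[of p n k] p by simp
  qed (rule half)
qed

section \<open>Reduction of stability to the gap between frequencies 1 and 2\<close>

lemma circulant_eigenvalue_second_difference:
  assumes "1 \<le> p"
  shows "4 * (\<Sum>d=1..k. cos (2 * pi * real d / real n) * (1 - cos (2 * pi * real p * real d / real n)))
    = circulant_eigenvalue n k (p + 1) + circulant_eigenvalue n k (p - 1) - 2 * circulant_eigenvalue n k 1"
proof -
  \<comment> \<open>Product-to-sum turns the modulation by the twisted state into a shift of the
    frequency by one in each direction.\<close>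
  have "4 * (cos (2 * pi * real d / real n) * (1 - cos (2 * pi * real p * real d / real n)))
    = 2 * (1 - cos (2 * pi * real (p + 1) * real d / real n)) + 2 * (1 - cos (2 * pi * real (p - 1) * real d / real n))
      - 4 * (1 - cos (2 * pi * real 1 * real d / real n))" for d
  proof -
    define x where "x = 2 * pi * real d / real n"
    define y where "y = 2 * pi * real p * real d / real n"
    have eqs: "2 * pi * real (p + 1) * real d / real n = y + x" "2 * pi * real (p - 1) * real d / real n = y - x"
      "2 * pi * real 1 * real d / real n = x"
      using assms by (simp_all add: x_def y_def of_nat_diff field_simps add_divide_distrib diff_divide_distrib)
    show ?thesis
      unfolding eqs x_def[symmetric] y_def[symmetric] cos_add cos_diff by (simp add: algebra_simps)
  qed
  then show ?thesis
    unfolding circulant_eigenvalue_def sum_distrib_left sum.distrib[symmetric] sum_subtractf[symmetric]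
    by (intro sum.cong refl) simp
qed

text \<open>For \<open>2 \<le> p \<le> n - 2\<close> both shifted frequencies are nonzero modulo
  \<open>n\<close>, so each eigenvalue is at least \<lambda>(1), one of them strictly. At
  \<open>p = 1\<close> and \<open>p = n - 1\<close> one shift lands on the zero mode, and the gap
  hypothesis takes over.\<close>

lemma twisted_curvature_positive:
  assumes n: "2 * k + 1 \<le> n" "n \<ge> 5" and k: "k \<ge> 1"
    and gap: "circulant_eigenvalue n k 2 > 2 * circulant_eigenvalue n k 1"
    and p: "1 \<le> p" "p < n"
  shows "(\<Sum>d=1..k. cos (2 * pi * real d / real n) * (1 - cos (2 * pi * real p * real d / real n))) > 0"
proof -
  \<comment> \<open>With no non-neighbours every nonzero frequency has eigenvalue
    \<open>2 * k + 1\<close>; with one, frequencies 1 and 2 give \<open>2 * k\<close> and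
    \<open>2 * k + 2\<close>. Either way \<open>gap\<close> fails.\<close>
  have n3: "2 * k + 3 \<le> n"
  proof (rule ccontr)
    assume "\<not> 2 * k + 3 \<le> n"
    then consider "n - (2 * k + 1) = 0" | "n - (2 * k + 1) = 1" using n by linarith
    then show False
    proof cases
      case 1
      then show False
        using gap circulant_eigenvalue_closed[of 1 n k] circulant_eigenvalue_closed[of 2 n k]
          sin_complement[OF n(1) refl, of 1] sin_complement[OF n(1) refl, of 2] n by simp
    next
      case 2
      have "sin (pi / real n) > 0" "sin (2 * (pi / real n)) > 0"
        using pi_fraction_bounds(3)[of 1 n] pi_fraction_bounds(3)[of 2 n] n by simp_all
      then show False
        using 2 gap circulant_eigenvalue_closed[of 1 n k] circulant_eigenvalue_closed[of 2 n k]
          sin_complement[OF n(1) refl, of 1] sin_complement[OF n(1) refl, of 2] n k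
        by simp
    qed
  qed
  have "0 < circulant_eigenvalue n k (p + 1) + circulant_eigenvalue n k (p - 1) - 2 * circulant_eigenvalue n k 1"
  proof -
    \<comment> \<open>The case \<open>p + 2 = n\<close> stands apart because \<open>p + 1\<close>
      then mirrors frequency 1, so strictness must come from \<open>p - 1\<close>.\<close>
    consider "p = 1" | "p = n - 1" | "2 \<le> p" "p + 3 \<le> n" | "p + 2 = n"
      using p by linarith
    then show ?thesis
    proof cases
      case 1
      then show ?thesis using gap by (simp add: numeral_2_eq_2)
    next
      case 2
      have "circulant_eigenvalue n k (p + 1) = 0" "circulant_eigenvalue n k (p - 1) = circulant_eigenvalue n k 2"
        using circulant_eigenvalue_reflect[of 0 n k] circulant_eigenvalue_reflect[of 2 n k] n 2
        by (simp_all add: numeral_2_eq_2)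
      then show ?thesis using gap by simp
    next
      case 3
      have "circulant_eigenvalue n k 1 < circulant_eigenvalue n k (p + 1)"
        by (rule circulant_eigenvalue_1_less[OF k n3]) (use 3 in auto)
      moreover have "circulant_eigenvalue n k 1 \<le> circulant_eigenvalue n k (p - 1)"
        by (rule circulant_eigenvalue_1_le[OF n(1)]) (use 3 in auto)
      ultimately show ?thesis by simp
    next
      case 4
      have "circulant_eigenvalue n k 1 < circulant_eigenvalue n k (p - 1)"
        by (rule circulant_eigenvalue_1_less[OF k n3]) (use 4 n in auto)
      moreover have "circulant_eigenvalue n k 1 \<le> circulant_eigenvalue n k (p + 1)"
        by (rule circulant_eigenvalue_1_le[OF n(1)]) (use 4 in auto)
      ultimately show ?thesis by simp
    qed
  qed
  then show ?thesis
    unfolding circulant_eigenvalue_second_difference[OF p(1), symmetric] by simp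
qed

text \<open>The gap inequality in the limit of vanishing \<open>h\<close>. The difference of the two
  sides has derivative \<open>2 * cos t * (1 - cos t)\<close>, nonpositive on this range, so it is
  smallest at \<open>2 * pi / 3\<close>, where \<open>5 * sqrt 3 / 4\<close> exceeds
  \<open>2 * pi / 3\<close>.\<close>

lemma sin_times_two_minus_cos:
  fixes a :: real
  assumes "pi / 2 \<le> a" "a \<le> 2 * pi / 3"
  shows "a < sin a * (2 - cos a)"
proof -
  define g where "g t = sin t * (2 - cos t) - t" for t :: real
  have "g (2 * pi / 3) \<le> g a"
  proof (rule DERIV_nonpos_imp_nonincreasing[OF assms(2)])
    fix t assume t: "a \<le> t" "t \<le> 2 * pi / 3"
    have "(g has_real_derivative cos t * (2 - cos t) + sin t * sin t - 1) (at t)"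
      unfolding g_def by (auto intro!: derivative_eq_intros)
    moreover have "cos t * (2 - cos t) + sin t * sin t - 1 = 2 * cos t * (1 - cos t)"
      using sin_cos_squared_add[of t] unfolding power2_eq_square by (simp add: algebra_simps)
    moreover have "cos t \<le> cos (pi / 2)"
      using t assms by (intro cos_monotone_0_pi_le) auto
    then have "2 * cos t * (1 - cos t) \<le> 0" by (simp add: mult_nonpos_nonneg)
    ultimately show "\<exists>l. (g has_real_derivative l) (at t) \<and> l \<le> 0" by metis
  qed
  moreover have "g (2 * pi / 3) > 0"
  proof -
    have "1.732 \<le> sqrt 3" by (rule real_le_rsqrt) (simp add: power2_eq_square)
    moreover have "pi < 3.2" using pi_approx by simp
    moreover have "g (2 * pi / 3) = sqrt 3 * 5 / 4 - 2 * pi / 3"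
      unfolding g_def sin_120 cos_120 by simp
    ultimately show ?thesis by simp
  qed
  ultimately show ?thesis by (simp add: g_def)
qed

text \<open>If \<open>4 * k \<le> n\<close>, all linked phases differ by at most a right angle, and
  every term of the curvature sum is nonnegative. Otherwise \<open>a\<close> lies between
  \<open>pi / 2\<close> and \<open>2 * pi / 3\<close>, where the limiting inequality
  applies.\<close>

lemma eigenvalue_gap_low_density:
  assumes n: "n \<ge> 5" and k: "k \<ge> 1" "3 * (2 * k + 1) \<le> 2 * n"
  shows "circulant_eigenvalue n k 2 > 2 * circulant_eigenvalue n k 1"
proof (cases "4 * k \<le> n")
  case True
  have x: "0 < 2 * pi * real d / real n" "2 * pi * real d / real n \<le> pi / 2" if "1 \<le> d" "d \<le> k" for d
  proof -
    have "4 * real d \<le> real n" using True that by linarith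
    then show "2 * pi * real d / real n \<le> pi / 2" using n by (simp add: field_simps)
    show "0 < 2 * pi * real d / real n" using that n by simp
  qed
  have "0 < (\<Sum>d=1..k. cos (2 * pi * real d / real n) * (1 - cos (2 * pi * real 1 * real d / real n)))"
  proof (rule sum_pos2[of _ 1])
    have "0 < cos (2 * pi / real n)" using n by (intro cos_gt_zero) (auto simp: field_simps)
    moreover have "cos (2 * pi / real n) < cos 0"
      using n by (intro cos_monotone_0_pi) (auto simp: field_simps)
    ultimately show "0 < cos (2 * pi * real 1 / real n) * (1 - cos (2 * pi * real 1 * real 1 / real n))" by simp
    show "0 \<le> cos (2 * pi * real d / real n) * (1 - cos (2 * pi * real 1 * real d / real n))" if "d \<in> {1..k}" for d
      using x[of d] that by (intro mult_nonneg_nonneg cos_ge_zero) auto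
  qed (use k in auto)
  then show ?thesis using circulant_eigenvalue_second_difference[of 1 n k] by (simp add: numeral_2_eq_2)
next
  case False
  define h where "h = pi / real n"
  define a where "a = real (2 * k + 1) * h"
  have h: "0 < h" "h < pi / 2" using n by (auto simp: h_def field_simps)
  have "n < 2 * (2 * k + 1)" using False by simp
  then have "real n < 2 * real (2 * k + 1)"
    unfolding of_nat_less_iff[where ?'a = real, symmetric] by simp
  moreover have "3 * real (2 * k + 1) \<le> 2 * real n"
    using k(2) unfolding of_nat_le_iff[where ?'a = real, symmetric] by simp
  ultimately have a: "pi / 2 \<le> a" "a \<le> 2 * pi / 3"
    using n by (auto simp: a_def h_def field_simps simp del: of_nat_add of_nat_mult of_nat_Suc)
  have s: "0 < sin h" "sin h \<le> h" "0 < cos h" "cos h \<le> 1"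
    using h sin_x_le_x[of h] by (auto intro: sin_gt_zero cos_gt_zero)
  have sa: "sin a > 0" using a pi_gt_zero by (intro sin_gt_zero) linarith+
  have "cos a \<le> cos (pi / 2)" using a by (intro cos_monotone_0_pi_le) auto
  then have ca: "cos a \<le> 0" by simp
  have "real (2 * k + 1) = a / h" using h by (simp add: a_def)
  also have "\<dots> < sin a * (2 - cos a) / h"
    using sin_times_two_minus_cos[OF a] h by (intro divide_strict_right_mono) auto
  also have "\<dots> = sin a / h * (2 - cos a)" by simp
  \<comment> \<open>Passing from the limit to finite \<open>h\<close> only helps:
    \<open>sin h \<le> h\<close> enlarges the first factor, and \<open>cos a \<le> 0\<close> with
    \<open>cos h \<le> 1\<close> enlarges the second.\<close>
  also have "\<dots> \<le> sin a / sin h * (2 - cos a / cos h)"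
  proof (intro mult_mono)
    show "sin a / h \<le> sin a / sin h" using s sa by (intro divide_left_mono) auto
    have "cos a / cos h \<le> cos a" using s ca by (simp add: divide_le_eq mult_le_cancel_left1)
    then show "2 - cos a \<le> 2 - cos a / cos h" by simp
  qed (use s sa ca in auto)
  also have "\<dots> = 2 * (sin a / sin h) - sin (2 * a) / sin (2 * h)"
    unfolding sin_double by (simp add: right_diff_distrib)
  finally have "real (2 * k + 1) < 2 * (sin a / sin h) - sin (2 * a) / sin (2 * h)" .
  moreover have "circulant_eigenvalue n k 1 = real (2 * k + 1) - sin a / sin h"
    using circulant_eigenvalue_closed[of 1 n k] n by (simp add: a_def h_def)
  moreover have "circulant_eigenvalue n k 2 = real (2 * k + 1) - sin (2 * a) / sin (2 * h)"
    using circulant_eigenvalue_closed[of 2 n k] n by (simp add: a_def h_def mult.left_commute)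
  ultimately show ?thesis by linarith
qed

section \<open>The limiting ratio\<close>

lemma sin_x_less_x:
  fixes x :: real
  assumes "0 < x"
  shows "sin x < x"
proof (cases "x \<le> 1")
  case True
  have "0 < cos (x / 2)" using True assms pi_gt3 by (intro cos_gt_zero) auto
  moreover have "cos (x / 2) < cos 0" using True assms pi_gt3 by (intro cos_monotone_0_pi) auto
  moreover have "sin (x / 2) \<le> x / 2" using assms by (intro sin_x_le_x) auto
  ultimately have "sin (x / 2) * cos (x / 2) \<le> x / 2 * cos (x / 2)" "x / 2 * cos (x / 2) < x / 2 * 1"
    using assms by (auto intro!: mult_right_mono mult_strict_left_mono)
  then show ?thesis using sin_double[of "x / 2"] by simp
next
  case False
  then show ?thesis using sin_le_one[of x] by linarith
qed

text \<open>At real points the powers of \<open>y - x\<close> are real, so the real parts of the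
  complex Taylor coefficients give a real power series for \<open>f\<close>.\<close>

lemma real_analytic_on_Re_holomorphic:
  assumes "open U" "F holomorphic_on U" "of_real ` S \<subseteq> U"
    and eq: "\<And>y. of_real y \<in> U \<Longrightarrow> F (of_real y) = of_real (f y)"
  shows "real_analytic_on f S"
  unfolding real_analytic_on_def
proof
  fix x assume "x \<in> S"
  then have "complex_of_real x \<in> U" using assms by auto
  then obtain r where r: "r > 0" "ball (complex_of_real x) r \<subseteq> U"
    using \<open>open U\<close> openE by blast
  have hol: "F holomorphic_on ball (complex_of_real x) r"
    using assms(2) r(2) holomorphic_on_subset by blast
  define a where "a m = Re ((deriv ^^ m) F (of_real x) / fact m)" for m
  have "(\<lambda>m. a m * (y - x) ^ m) sums f y" if y: "\<bar>y - x\<bar> < r" for y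
  proof -
    have mem: "complex_of_real y \<in> ball (complex_of_real x) r"
      using y by (simp add: dist_norm norm_minus_commute flip: of_real_diff)
    have "(\<lambda>m. (deriv ^^ m) F (of_real x) / fact m * (of_real y - of_real x) ^ m) sums F (of_real y)"
      using hol mem by (rule holomorphic_power_series)
    then have "(\<lambda>m. Re ((deriv ^^ m) F (of_real x) / fact m * (of_real y - of_real x) ^ m)) sums Re (F (of_real y))"
      by (rule sums_Re)
    moreover have "Re ((deriv ^^ m) F (of_real x) / fact m * (of_real y - of_real x) ^ m) = a m * (y - x) ^ m" for m
    proof -
      have "(complex_of_real y - of_real x) ^ m = of_real ((y - x) ^ m)" by simp
      then show ?thesis unfolding a_def by (simp only: Re_complex_of_real Im_complex_of_real times_complex.sel)
    qed
    ultimately show ?thesis using eq[of y] mem r by (auto simp: subset_iff)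
  qed
  then show "\<exists>r>0. \<exists>a. \<forall>y. \<bar>y - x\<bar> < r \<longrightarrow> (\<lambda>m. a m * (y - x) ^ m) sums f y"
    using r by blast
qed

section \<open>The limit function and the critical density\<close>

definition limit_ratio :: "real \<Rightarrow> real" where
  "limit_ratio \<mu> = (2 * (pi * \<mu>) - sin (2 * (pi * \<mu>))) / (2 * (pi * \<mu> - sin (pi * \<mu>)))"

lemma real_analytic_limit_ratio:
  assumes "\<And>x. x \<in> S \<Longrightarrow> x > 0"
  shows "real_analytic_on limit_ratio S"
proof (rule real_analytic_on_Re_holomorphic)
  define p where "p = complex_of_real pi"
  define U where "U = {z. p * z - sin (p * z) \<noteq> 0}"
  define F where "F z = (2 * (p * z) - sin (2 * (p * z))) / (2 * (p * z - sin (p * z)))" for z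
  show "open U" unfolding U_def by (intro open_Collect_neq continuous_intros)
  show "F holomorphic_on U" unfolding F_def U_def by (intro holomorphic_intros) auto
  show "F (of_real y) = of_real (limit_ratio y)" for y
    by (simp add: F_def p_def limit_ratio_def sin_of_real[symmetric] del: sin_of_real)
  show "complex_of_real ` S \<subseteq> U"
  proof
    fix z assume "z \<in> complex_of_real ` S"
    then obtain x where x: "z = of_real x" "x > 0" using assms by auto
    have "p * z - sin (p * z) = of_real (pi * x - sin (pi * x))"
      by (simp add: x p_def sin_of_real[symmetric] del: sin_of_real)
    moreover have "pi * x - sin (pi * x) \<noteq> 0" using sin_x_less_x[of "pi * x"] x by simp
    ultimately show "z \<in> U" unfolding U_def by (simp only: mem_Collect_eq of_real_eq_0_iff not_False_eq_True)
  qed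
qed

text \<open>Obtained by doubling a quadratic bound at \<open>pi / 5\<close>. The true value is about
  0.309; what matters is a strict margin over the threshold 0.28.\<close>

lemma cos_two_fifths_pi: "cos (2 * pi / 5) > 284 / 1000"
proof -
  have "(pi / 5)\<^sup>2 \<le> (63 / 100)\<^sup>2" using pi_approx by (intro power_mono) auto
  then have "cos (pi / 5) \<ge> 8015 / 10000"
    using cos_ge_quadratic[of "pi / 5"] by (simp add: power2_eq_square)
  then have "(cos (pi / 5))\<^sup>2 \<ge> (8015 / 10000)\<^sup>2" by (intro power_mono) auto
  then show ?thesis using cos_double_cos[of "pi / 5"] by (simp add: power2_eq_square)
qed

lemma cos_le_of_high_density:
  assumes "0.6 * pi \<le> t" "t \<le> pi"
  shows "cos t < - 0.284"
proof -
  have "cos t \<le> cos (pi - 2 * pi / 5)" using assms by (intro cos_monotone_0_pi_le) auto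
  also have "\<dots> = - cos (2 * pi / 5)" unfolding cos_diff by simp
  finally show ?thesis using cos_two_fifths_pi by simp
qed

text \<open>If \<open>cos t < - 1 / 2\<close>, the left side is negative. Otherwise
  \<open>t \<le> 2.1\<close> and \<open>sin t \<ge> 0.8\<close>, and the number 1.2 separates the
  sides.\<close>

lemma limit_ratio_derivative_sign:
  fixes t :: real
  assumes t: "0.6 * pi \<le> t" "t \<le> pi"
  shows "t * (1 + 2 * cos t) < sin t * (2 + cos t)"
proof -
  have c: "cos t < - 0.284" by (rule cos_le_of_high_density[OF t])
  have t0: "t > 0" using t pi_gt_zero by linarith
  have s0: "sin t \<ge> 0" using t t0 by (intro sin_ge_zero) auto
  have sq: "sin t * sin t + cos t * cos t = 1"
    using sin_cos_squared_add[of t] by (simp add: power2_eq_square)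
  consider "cos t < - 1 / 2" | "cos t \<ge> - 1 / 2" by linarith
  then show ?thesis
  proof cases
    case 1
    have "t * (1 + 2 * cos t) < 0" using t0 1 by (intro mult_pos_neg) auto
    also have "0 \<le> sin t * (2 + cos t)" using s0 cos_ge_minus_one[of t] by (intro mult_nonneg_nonneg) linarith+
    finally show ?thesis .
  next
    case 2
    have "t \<le> 2 * pi / 3"
    proof (rule ccontr)
      assume "\<not> t \<le> 2 * pi / 3"
      then have "cos t < cos (2 * pi / 3)" using t by (intro cos_monotone_0_pi) auto
      then show False using 2 unfolding cos_120 by simp
    qed
    then have "t \<le> 2.1" using pi_approx by simp
    then have "t * (1 + 2 * cos t) \<le> 2.1 * (1 + 2 * cos t)" using 2 by (intro mult_right_mono) auto
    also have "\<dots> < 1.2" using c by simp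
    also have "\<dots> \<le> 0.8 * (2 + cos t)" using 2 by simp
    also have "\<dots> \<le> sin t * (2 + cos t)"
    proof (rule mult_right_mono)
      have "cos t * cos t \<le> (1 / 2) * (1 / 2)"
        using abs_le_square_iff[of "cos t" "1 / 2"] c 2 by (simp add: power2_eq_square)
      then have "0.8\<^sup>2 \<le> (sin t)\<^sup>2" using sq by (simp add: power2_eq_square)
      then show "0.8 \<le> sin t" using s0 by (rule power2_le_imp_le)
    qed (use 2 in auto)
    finally show ?thesis .
  qed
qed

text \<open>The double-angle formulas factor the quotient-rule numerator; splitting off
  \<open>1 - cos (pi * \<mu>)\<close> leaves the difference treated in
  \<open>limit_ratio_derivative_sign\<close>.\<close>

lemma limit_ratio_has_derivative:
  assumes "\<mu> > 0"
  shows "(limit_ratio has_real_derivative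
    pi * (4 * (1 - cos (pi * \<mu>)) * (pi * \<mu> * (1 + 2 * cos (pi * \<mu>)) - sin (pi * \<mu>) * (2 + cos (pi * \<mu>))))
      / (2 * (pi * \<mu> - sin (pi * \<mu>)))\<^sup>2) (at \<mu>)"
proof -
  define t where "t = pi * \<mu>"
  have pos: "2 * (pi * \<mu> - sin (pi * \<mu>)) \<noteq> 0" using sin_x_less_x[of "pi * \<mu>"] assms by simp
  have "(2 * pi - cos (2 * t) * (2 * pi)) * (2 * (t - sin t)) - (2 * t - sin (2 * t)) * (2 * (pi - cos t * pi))
      = pi * (4 * (1 - cos t) * (t * (1 + 2 * cos t) - sin t * (2 + cos t)))"
    unfolding sin_double cos_double_cos by (simp add: power2_eq_square algebra_simps)
  moreover have "(limit_ratio has_real_derivative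
      ((2 * pi - cos (2 * t) * (2 * pi)) * (2 * (t - sin t)) - (2 * t - sin (2 * t)) * (2 * (pi - cos t * pi)))
        / ((2 * (t - sin t)) * (2 * (t - sin t)))) (at \<mu>)"
    unfolding limit_ratio_def t_def using pos
    by (auto intro!: derivative_eq_intros) (simp add: algebra_simps)
  ultimately show ?thesis by (simp add: t_def power2_eq_square)
qed

lemma limit_ratio_decreasing: "strict_antimono_on {0.6..1} limit_ratio"
proof (rule monotone_onI)
  fix x y :: real
  assume xy: "x \<in> {0.6..1}" "y \<in> {0.6..1}" "x < y"
  show "limit_ratio y < limit_ratio x"
  proof (rule DERIV_neg_imp_decreasing[OF xy(3)])
    fix u assume u: "x \<le> u" "u \<le> y"
    define t where "t = pi * u"
    have t: "0.6 * pi \<le> t" "t \<le> pi" using u xy by (auto simp: t_def)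
    have "t > 0" using t pi_gt_zero by linarith
    then have "t - sin t > 0" using sin_x_less_x by simp
    moreover have "1 - cos t > 0" using cos_le_of_high_density[OF t] by simp
    ultimately have "pi * (4 * (1 - cos t) * (t * (1 + 2 * cos t) - sin t * (2 + cos t))) / (2 * (t - sin t))\<^sup>2 < 0"
      using limit_ratio_derivative_sign[OF t]
      by (intro divide_neg_pos mult_pos_neg) auto
    then show "\<exists>l. (limit_ratio has_real_derivative l) (at u) \<and> l < 0"
      using limit_ratio_has_derivative[of u] u xy unfolding t_def by auto
  qed
qed

lemma limit_ratio_eq_2_iff:
  assumes "m > 0"
  shows "limit_ratio m = 2 \<longleftrightarrow> 2 * (1 - sin (pi * m) / (pi * m)) = 1 - sin (2 * pi * m) / (2 * pi * m)"
proof -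
  define t where "t = pi * m"
  have t: "t > 0" using assms by (simp add: t_def)
  then have "t - sin t > 0" using sin_x_less_x by simp
  then have "limit_ratio m = 2 \<longleftrightarrow> 2 * t - sin (2 * t) = 4 * (t - sin t)"
    by (simp add: limit_ratio_def t_def[symmetric] divide_eq_eq)
  also have "\<dots> \<longleftrightarrow> 2 * (1 - sin t / t) = 1 - sin (2 * t) / (2 * t)"
  proof -
    have "2 * (1 - sin t / t) = 4 * (t - sin t) / (2 * t)" "1 - sin (2 * t) / (2 * t) = (2 * t - sin (2 * t)) / (2 * t)"
      using t by (simp_all add: diff_divide_distrib right_diff_distrib)
    then show ?thesis using t by auto
  qed
  finally show ?thesis by (simp add: t_def mult.assoc)
qed

lemma isCont_limit_ratio: "\<mu> > 0 \<Longrightarrow> isCont limit_ratio \<mu>"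
  using limit_ratio_has_derivative DERIV_isCont by blast

text \<open>Left endpoint for the intermediate value argument that locates the critical density; the
  true value is about 2.06.\<close>

lemma limit_ratio_two_thirds: "limit_ratio (2 / 3) > 2"
proof -
  have eqs: "pi * (2 / 3) = 2 * pi / 3" "2 * (2 * pi / 3) = pi + pi / 3" by simp_all
  have s: "sin (2 * (2 * pi / 3)) = - (sqrt 3 / 2)"
    unfolding eqs(2) sin_add by (simp add: sin_60)
  have "sqrt 3 \<ge> 1.73" by (rule real_le_rsqrt) (simp add: power2_eq_square)
  moreover have "sqrt 3 \<le> 1.74" by (rule real_le_lsqrt) (simp_all add: power2_eq_square)
  moreover have "pi < 3.15" "pi > 3" using pi_approx by simp_all
  ultimately show ?thesis
    unfolding limit_ratio_def eqs(1) s sin_120 by (simp add: less_divide_eq)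
qed

lemma limit_ratio_1: "limit_ratio 1 = 1"
  by (simp add: limit_ratio_def)

text \<open>The intermediate value theorem on \<open>{2/3..1}\<close> gives a solution, and strict
  monotonicity makes it unique in all of \<open>{0.6..1}\<close>, so the definite description is
  well defined.\<close>

lemma critical_density:
  shows "limit_ratio critical_density = 2" "2 / 3 < critical_density" "critical_density < 1"
proof -
  have "\<exists>x\<ge>2/3. x \<le> 1 \<and> limit_ratio x = 2"
    using limit_ratio_two_thirds limit_ratio_1 isCont_limit_ratio by (intro IVT2) auto
  then obtain m where m: "2 / 3 \<le> m" "m \<le> 1" "limit_ratio m = 2" by blast
  have "critical_density = m"
    unfolding critical_density_def
  proof (rule the_equality)
    show "m \<in> {0.6..1} \<and> 2 * (1 - sin (pi * m) / (pi * m)) = 1 - sin (2 * pi * m) / (2 * pi * m)"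
      using m limit_ratio_eq_2_iff[of m] by auto
    fix x assume x: "x \<in> {0.6..1} \<and> 2 * (1 - sin (pi * x) / (pi * x)) = 1 - sin (2 * pi * x) / (2 * pi * x)"
    then have "limit_ratio x = 2" using limit_ratio_eq_2_iff[of x] by auto
    moreover have "m \<in> {0.6..1}" using m by auto
    ultimately show "x = m"
      using monotone_onD[OF limit_ratio_decreasing, of x m] monotone_onD[OF limit_ratio_decreasing, of m x] x m
      by (cases x m rule: linorder_cases) auto
  qed
  moreover have "m \<noteq> 2 / 3" "m \<noteq> 1" using m(3) limit_ratio_two_thirds limit_ratio_1 by (metis less_irrefl, fastforce)
  ultimately show "limit_ratio critical_density = 2" "2 / 3 < critical_density" "critical_density < 1"
    using m by auto
qed

section \<open>Limits along graphs of growing size and convergent density\<close>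

lemma tendsto_times_sin_divide:
  fixes c :: real
  shows "((\<lambda>x. x * sin (c / x)) \<longlongrightarrow> c) at_top"
  by real_asymp

context
  fixes n k :: "nat \<Rightarrow> nat" and \<mu> :: real
  assumes nk: "\<And>s. 2 * k s + 1 \<le> n s"
    and n_lim: "filterlim n at_top sequentially"
    and density: "(\<lambda>s. 2 * real (k s) / real (n s)) \<longlonglongrightarrow> \<mu>"
    and high: "\<mu> \<ge> 0.6"
begin

lemma real_n_lim: "filterlim (\<lambda>s. real (n s)) at_top sequentially"
  using filterlim_compose[OF filterlim_real_sequentially n_lim] .

lemma density_le_1: "\<mu> \<le> 1"
proof (rule LIMSEQ_le_const2[OF density], intro exI allI impI)
  fix s
  show "2 * real (k s) / real (n s) \<le> 1"
    using nk[of s] by (simp add: divide_le_eq)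
qed

lemma density_odd: "(\<lambda>s. real (2 * k s + 1) / real (n s)) \<longlonglongrightarrow> \<mu>"
proof -
  have "(\<lambda>s. 1 / real (n s)) \<longlonglongrightarrow> 0"
    using tendsto_divide_0[OF tendsto_const filterlim_at_top_imp_at_infinity[OF real_n_lim]] .
  from tendsto_add[OF density this] show ?thesis by (simp add: add_divide_distrib add.commute)
qed

text \<open>The angle tends to \<open>pi - \<mu> * pi\<close>, whose cosine exceeds 0.28 strictly
  even at density 0.6, so the bound persists along the sequence.\<close>

lemma eventually_high_density:
  "\<forall>\<^sub>F s in sequentially. n s \<ge> 20 \<and> cos (real (n s - (2 * k s + 1)) * (pi / real (n s))) \<ge> 28 / 100"
proof (rule eventually_conj)
  show "\<forall>\<^sub>F s in sequentially. n s \<ge> 20"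
    using n_lim by (simp add: filterlim_at_top)
  have "(\<lambda>s. cos (pi - real (2 * k s + 1) / real (n s) * pi)) \<longlonglongrightarrow> cos (pi - \<mu> * pi)"
    by (intro tendsto_intros density_odd)
  moreover have "cos (pi - \<mu> * pi) > 28 / 100"
    using cos_le_of_high_density[of "\<mu> * pi"] high density_le_1 by (simp add: cos_diff)
  ultimately have "\<forall>\<^sub>F s in sequentially. cos (pi - real (2 * k s + 1) / real (n s) * pi) > 28 / 100"
    by (rule order_tendstoD(1))
  moreover have "real (n s - (2 * k s + 1)) * (pi / real (n s)) = pi - real (2 * k s + 1) / real (n s) * pi" for s
    unfolding of_nat_diff[OF nk] using nk[of s] by (simp add: field_simps)
  ultimately show "\<forall>\<^sub>F s in sequentially. cos (real (n s - (2 * k s + 1)) * (pi / real (n s))) \<ge> 28 / 100"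
    by (auto elim: eventually_mono)
qed

text \<open>Eigenvalues grow linearly in \<open>n\<close>. After division by \<open>n\<close> the
  denominator of the closed form becomes \<open>n * sin (p * pi / n)\<close>, which tends to
  \<open>p * pi\<close>.\<close>

lemma eigenvalue_scaled_limit:
  assumes "1 \<le> p"
  shows "(\<lambda>s. circulant_eigenvalue (n s) (k s) p / real (n s)) \<longlonglongrightarrow> \<mu> - sin (real p * (pi * \<mu>)) / (real p * pi)"
proof (rule Lim_transform_eventually)
  have "(\<lambda>s. real (n s) * sin (real p * pi / real (n s))) \<longlonglongrightarrow> real p * pi"
    using filterlim_compose[OF tendsto_times_sin_divide real_n_lim] .
  then show "(\<lambda>s. real (2 * k s + 1) / real (n s) - sin (real p * (pi * (real (2 * k s + 1) / real (n s))))
      / (real (n s) * sin (real p * pi / real (n s)))) \<longlonglongrightarrow> \<mu> - sin (real p * (pi * \<mu>)) / (real p * pi)"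
    using assms by (intro tendsto_diff density_odd tendsto_divide tendsto_sin tendsto_mult_left) auto
  have "\<forall>\<^sub>F s in sequentially. n s > p"
    using filterlim_at_top[THEN iffD1, OF n_lim, rule_format, of "Suc p"] by (simp add: Suc_le_eq)
  then show "\<forall>\<^sub>F s in sequentially. real (2 * k s + 1) / real (n s) - sin (real p * (pi * (real (2 * k s + 1) / real (n s))))
      / (real (n s) * sin (real p * pi / real (n s))) = circulant_eigenvalue (n s) (k s) p / real (n s)"
  proof (rule eventually_mono)
    fix s assume s: "p < n s"
    have eqs: "real p * (pi * (real (2 * k s + 1) / real (n s))) = real (2 * k s + 1) * (real p * (pi / real (n s)))"
      "real p * pi / real (n s) = real p * (pi / real (n s))" by simp_all
    then show "real (2 * k s + 1) / real (n s) - sin (real p * (pi * (real (2 * k s + 1) / real (n s))))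
      / (real (n s) * sin (real p * pi / real (n s))) = circulant_eigenvalue (n s) (k s) p / real (n s)"
      unfolding circulant_eigenvalue_closed[OF assms s] eqs diff_divide_distrib
      by (simp only: divide_divide_eq_left mult.commute[of "real (n s)"])
  qed
qed

lemma eigenvalue_ratio_limit:
  "(\<lambda>s. circulant_eigenvalue (n s) (k s) 2 / circulant_eigenvalue (n s) (k s) 1) \<longlonglongrightarrow> limit_ratio \<mu>"
proof (rule Lim_transform_eventually)
  have pos: "pi * \<mu> - sin (pi * \<mu>) > 0" using sin_x_less_x[of "pi * \<mu>"] high by simp
  have "\<mu> - sin (real 1 * (pi * \<mu>)) / (real 1 * pi) = (pi * \<mu> - sin (pi * \<mu>)) / pi"
    by (simp add: diff_divide_distrib)
  moreover have "\<mu> - sin (real 2 * (pi * \<mu>)) / (real 2 * pi) = (2 * (pi * \<mu>) - sin (2 * (pi * \<mu>))) / (2 * pi)"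
    by (simp add: diff_divide_distrib)
  ultimately have "(\<mu> - sin (real 2 * (pi * \<mu>)) / (real 2 * pi)) / (\<mu> - sin (real 1 * (pi * \<mu>)) / (real 1 * pi)) = limit_ratio \<mu>"
    unfolding limit_ratio_def using pos by simp
  moreover have "\<mu> - sin (real 1 * (pi * \<mu>)) / (real 1 * pi) \<noteq> 0"
    using pos by (simp add: field_simps)
  ultimately show "(\<lambda>s. (circulant_eigenvalue (n s) (k s) 2 / real (n s)) / (circulant_eigenvalue (n s) (k s) 1 / real (n s)))
      \<longlonglongrightarrow> limit_ratio \<mu>"
    using tendsto_divide[OF eigenvalue_scaled_limit[of 2] eigenvalue_scaled_limit[of 1]] by simp
  have "n s > 0" for s using nk[of s] by simp
  then show "\<forall>\<^sub>F s in sequentially. (circulant_eigenvalue (n s) (k s) 2 / real (n s)) / (circulant_eigenvalue (n s) (k s) 1 / real (n s))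
      = circulant_eigenvalue (n s) (k s) 2 / circulant_eigenvalue (n s) (k s) 1"
    by simp
qed

end

lemma exists_sequence_with_density:
  assumes "0 < \<mu>" "\<mu> < 1"
  obtains n k :: "nat \<Rightarrow> nat" where "\<And>s. 1 \<le> k s \<and> 2 * k s + 1 \<le> n s"
    "filterlim n at_top sequentially" "filterlim k at_top sequentially"
    "(\<lambda>s. 2 * real (k s) / real (n s)) \<longlonglongrightarrow> \<mu>"
proof -
  \<comment> \<open>The first bound makes \<open>k s\<close> at least 1 after rounding down; the
    second leaves room for \<open>2 * k s + 1 \<le> n s\<close>.\<close>
  obtain N :: nat where N: "real N \<ge> max (2 / \<mu>) (1 / (1 - \<mu>))" using real_arch_simple by blast
  define n where "n s = s + N" for s
  define k where "k s = nat \<lfloor>\<mu> * real (n s) / 2\<rfloor>" for s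
  have big: "\<mu> * real (n s) \<ge> 2" "real (n s) * (1 - \<mu>) \<ge> 1" for s
  proof -
    have "real (n s) \<ge> 2 / \<mu>" "real (n s) \<ge> 1 / (1 - \<mu>)" using N by (auto simp: n_def)
    then show "\<mu> * real (n s) \<ge> 2" "real (n s) * (1 - \<mu>) \<ge> 1"
      using assms by (simp_all add: divide_le_eq mult.commute)
  qed
  have k: "real (k s) \<le> \<mu> * real (n s) / 2" "real (k s) > \<mu> * real (n s) / 2 - 1" for s
  proof -
    have "real (k s) = of_int \<lfloor>\<mu> * real (n s) / 2\<rfloor>"
      unfolding k_def using assms by (intro of_nat_nat) simp
    then show "real (k s) \<le> \<mu> * real (n s) / 2" "real (k s) > \<mu> * real (n s) / 2 - 1" by linarith+
  qed
  have n_pos: "real (n s) > 0" for s using big(1)[of s] assms by (smt (verit) mult_nonneg_nonpos)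
  have n_lim: "filterlim n at_top sequentially"
    unfolding n_def by (rule filterlim_at_top_mono[OF filterlim_ident]) simp
  have real_n: "filterlim (\<lambda>s. real (n s)) at_top sequentially"
    using filterlim_compose[OF filterlim_real_sequentially n_lim] .
  have inv: "(\<lambda>s. 2 / real (n s)) \<longlonglongrightarrow> 0"
    using tendsto_divide_0[OF tendsto_const filterlim_at_top_imp_at_infinity[OF real_n]] .
  show thesis
  proof
    show "1 \<le> k s \<and> 2 * k s + 1 \<le> n s" for s
    proof
      have "real (k s) > 0" using k(2)[of s] big(1)[of s] by simp
      then show "1 \<le> k s" by simp
      have "2 * real (k s) + 1 \<le> real (n s)"
        using k(1)[of s] big(2)[of s] by (simp add: algebra_simps)
      then have "real (2 * k s + 1) \<le> real (n s)" by simp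
      then show "2 * k s + 1 \<le> n s" by (simp only: of_nat_le_iff)
    qed
    show "filterlim n at_top sequentially" by fact
    show "(\<lambda>s. 2 * real (k s) / real (n s)) \<longlonglongrightarrow> \<mu>"
    proof (rule tendsto_sandwich)
      show "(\<lambda>s. \<mu> - 2 / real (n s)) \<longlonglongrightarrow> \<mu>" using tendsto_diff[OF tendsto_const inv, of \<mu>] by simp
      show "(\<lambda>s. \<mu>) \<longlonglongrightarrow> \<mu>" by simp
      show "\<forall>\<^sub>F s in sequentially. \<mu> - 2 / real (n s) \<le> 2 * real (k s) / real (n s)"
      proof (rule always_eventually, rule allI)
        fix s
        have "\<mu> * real (n s) - 2 \<le> 2 * real (k s)" using k(2)[of s] by simp
        then have "(\<mu> * real (n s) - 2) / real (n s) \<le> 2 * real (k s) / real (n s)"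
          using n_pos[of s] by (intro divide_right_mono) auto
        then show "\<mu> - 2 / real (n s) \<le> 2 * real (k s) / real (n s)"
          using n_pos[of s] by (simp add: diff_divide_distrib)
      qed
      show "\<forall>\<^sub>F s in sequentially. 2 * real (k s) / real (n s) \<le> \<mu>"
      proof (rule always_eventually, rule allI)
        fix s
        show "2 * real (k s) / real (n s) \<le> \<mu>"
          using k(1)[of s] n_pos[of s] by (simp add: divide_le_eq mult.commute)
      qed
    qed
    have "filterlim (\<lambda>s. (\<mu> / 2) * real (n s)) at_top sequentially"
      using assms real_n by (intro filterlim_tendsto_pos_mult_at_top[OF tendsto_const]) auto
    then have "filterlim (\<lambda>s. - 1 + (\<mu> / 2) * real (n s)) at_top sequentially"
      by (rule filterlim_tendsto_add_at_top[OF tendsto_const])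
    then have "filterlim (\<lambda>s. real (k s)) at_top sequentially"
      by (rule filterlim_at_top_mono) (use k(2) in \<open>auto intro!: always_eventually less_imp_le simp: algebra_simps\<close>)
    then show "filterlim k at_top sequentially"
      by (simp add: filterlim_sequentially_iff_filterlim_real)
  qed
qed

section \<open>Stability of the twisted state and the eigenvalue ratio\<close>

lemma laplacian_ratio_high_density:
  assumes n: "2 * k + 1 \<le> n" "n \<ge> 20"
    and b: "cos (real (n - (2 * k + 1)) * (pi / real n)) \<ge> 28 / 100"
  shows "laplacian_ratio n k = circulant_eigenvalue n k 2 / circulant_eigenvalue n k 1"
proof -
  have "ith_eigenvalue n (laplacian (circulant_adj n k)) = circulant_eigenvalue n k 2"
    using n circulant_eigenvalue_le_2[OF n _ b] by (intro ith_eigenvalue_n_laplacian) auto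
  moreover have "ith_eigenvalue 2 (laplacian (circulant_adj n k)) = circulant_eigenvalue n k 1"
    using n circulant_eigenvalue_1_le[OF n(1)] by (intro ith_eigenvalue_2_laplacian) auto
  ultimately show ?thesis by (simp add: laplacian_ratio_def Let_def)
qed

text \<open>Up to density 2/3 the gap holds regardless of the ratio. Above it the complementary
  angle is at most \<open>pi / 3\<close>, so frequency 2 carries the largest eigenvalue and the
  ratio hypothesis is the gap itself.\<close>

lemma eigenvalue_gap_of_ratio_gt_2:
  assumes n: "n \<ge> 20" and k: "1 \<le> k" "2 * k + 1 \<le> n" and ratio: "laplacian_ratio n k > 2"
  shows "circulant_eigenvalue n k 2 > 2 * circulant_eigenvalue n k 1"
proof (cases "3 * (2 * k + 1) \<le> 2 * n")
  case True
  then show ?thesis using n k by (intro eigenvalue_gap_low_density) auto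
next
  case False
  define m where "m = n - (2 * k + 1)"
  have "3 * m \<le> n" using False by (simp add: m_def)
  then have "3 * real m \<le> real n" unfolding of_nat_le_iff[where ?'a = real, symmetric] by simp
  then have "real m * (pi / real n) \<le> pi / 3" using n by (simp add: field_simps)
  then have "cos (pi / 3) \<le> cos (real m * (pi / real n))"
    by (intro cos_monotone_0_pi_le) auto
  then have "cos (real (n - (2 * k + 1)) * (pi / real n)) \<ge> 28 / 100"
    by (simp add: cos_60 m_def)
  from laplacian_ratio_high_density[OF k(2) n this] ratio
  have gap: "circulant_eigenvalue n k 2 / circulant_eigenvalue n k 1 > 2" by simp
  then have "circulant_eigenvalue n k 1 \<noteq> 0" by auto
  then have "circulant_eigenvalue n k 1 > 0" using circulant_eigenvalue_nonneg[of n k 1] by simp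
  then show ?thesis using gap by (simp add: less_divide_eq)
qed

lemma stable_equilibrium_of_ratio_gt_2:
  assumes "K > 0" "n \<ge> 20" "1 \<le> k" "2 * k + 1 \<le> n" "laplacian_ratio n k > 2"
  shows "\<exists>\<theta>. stable_equilibrium K (circulant_adj n k) \<theta> \<and> unsynchronized \<theta>"
proof (intro exI conjI)
  have "circulant_eigenvalue n k 2 > 2 * circulant_eigenvalue n k 1"
    by (rule eigenvalue_gap_of_ratio_gt_2) fact+
  then show "stable_equilibrium K (circulant_adj n k) (twisted_state n)"
    using assms twisted_curvature_positive[of k n] by (intro stable_twisted_state) auto
  show "unsynchronized (twisted_state n)"
    using assms by (intro unsynchronized_twisted_state) auto
qed

lemma laplacian_ratio_limit:
  assumes nk: "\<And>s. 2 * k s + 1 \<le> n s" and "filterlim n at_top sequentially"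
    and "(\<lambda>s. 2 * real (k s) / real (n s)) \<longlonglongrightarrow> \<mu>" "\<mu> \<ge> 0.6"
  shows "(\<lambda>s. laplacian_ratio (n s) (k s)) \<longlonglongrightarrow> limit_ratio \<mu>"
proof (rule Lim_transform_eventually)
  show "(\<lambda>s. circulant_eigenvalue (n s) (k s) 2 / circulant_eigenvalue (n s) (k s) 1) \<longlonglongrightarrow> limit_ratio \<mu>"
    using assms by (rule eigenvalue_ratio_limit)
  have "\<forall>\<^sub>F s in sequentially. n s \<ge> 20 \<and> cos (real (n s - (2 * k s + 1)) * (pi / real (n s))) \<ge> 28 / 100"
    using assms by (rule eventually_high_density)
  then show "\<forall>\<^sub>F s in sequentially. circulant_eigenvalue (n s) (k s) 2 / circulant_eigenvalue (n s) (k s) 1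
      = laplacian_ratio (n s) (k s)"
    by (rule eventually_mono) (use laplacian_ratio_high_density[OF nk] in auto)
qed

text \<open>At a density slightly below critical the limiting ratio lies strictly between 2 and
  \<open>2 + \<epsilon>\<close>; a sufficiently late member of any sequence of graphs with that
  limiting density inherits both bounds.\<close>

lemma exists_stable_near_2:
  assumes K: "K > 0" and \<epsilon>: "\<epsilon> > 0"
  shows "\<exists>n k :: nat. 1 \<le> k \<and> 2 * k + 1 \<le> n \<and>
    (\<exists>\<theta>. stable_equilibrium K (circulant_adj n k) \<theta> \<and> unsynchronized \<theta>) \<and> laplacian_ratio n k \<le> 2 + \<epsilon>"
proof -
  let ?c = critical_density
  have "isCont limit_ratio ?c" using critical_density by (intro isCont_limit_ratio) auto
  then obtain \<delta> where \<delta>: "\<delta> > 0" "\<And>x. \<bar>x - ?c\<bar> < \<delta> \<Longrightarrow> \<bar>limit_ratio x - limit_ratio ?c\<bar> < \<epsilon>"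
    using \<epsilon> unfolding continuous_at_eps_delta dist_real_def by blast
  \<comment> \<open>The maximum with 2/3 keeps the density where \<open>limit_ratio\<close> is known
    to decrease, and it stays below the critical density, which exceeds 2/3.\<close>
  define \<mu> where "\<mu> = max (2 / 3) (?c - \<delta> / 2)"
  have \<mu>: "\<mu> \<ge> 2 / 3" "\<mu> < ?c" "\<bar>\<mu> - ?c\<bar> < \<delta>"
    using critical_density \<delta>(1) by (auto simp: \<mu>_def max_def)
  have \<mu>01: "0 < \<mu>" "\<mu> < 1" using \<mu> critical_density(3) by linarith+
  have "limit_ratio \<mu> > 2"
    using monotone_onD[OF limit_ratio_decreasing, of \<mu> ?c] \<mu> critical_density by simp
  moreover have "limit_ratio \<mu> < 2 + \<epsilon>"
    using \<delta>(2)[OF \<mu>(3)] critical_density(1) by simp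
  moreover obtain n k :: "nat \<Rightarrow> nat" where nk: "\<And>s. 1 \<le> k s \<and> 2 * k s + 1 \<le> n s"
    and n: "filterlim n at_top sequentially" and dens: "(\<lambda>s. 2 * real (k s) / real (n s)) \<longlonglongrightarrow> \<mu>"
    using exists_sequence_with_density[OF \<mu>01] by blast
  have lim: "(\<lambda>s. laplacian_ratio (n s) (k s)) \<longlonglongrightarrow> limit_ratio \<mu>"
    using nk n dens \<mu> by (intro laplacian_ratio_limit) auto
  ultimately have "\<forall>\<^sub>F s in sequentially. laplacian_ratio (n s) (k s) > 2 \<and> laplacian_ratio (n s) (k s) < 2 + \<epsilon> \<and> n s \<ge> 20"
    using order_tendstoD[OF lim] filterlim_at_top[THEN iffD1, OF n, rule_format, of 20]
    by (intro eventually_conj) auto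
  then obtain s where s: "laplacian_ratio (n s) (k s) > 2" "laplacian_ratio (n s) (k s) < 2 + \<epsilon>" "n s \<ge> 20"
    using eventually_happens'[OF sequentially_bot] by blast
  then show ?thesis
    using stable_equilibrium_of_ratio_gt_2[OF K s(3) _ _ s(1)] nk[of s]
    by (intro exI[of _ "n s"] exI[of _ "k s"]) auto
qed

theorem theorem3p5:
  fixes K :: real
  assumes "K > 0"
  shows
    "(\<forall>\<^sub>F n in sequentially. \<forall>k::nat. 1 \<le> k \<and> 2 * k + 1 \<le> n \<and> laplacian_ratio n k > 2 \<longrightarrow>
        (\<exists>\<theta>. stable_equilibrium K (circulant_adj n k) \<theta> \<and> unsynchronized \<theta>)) \<and>
     (\<exists>\<kappa> :: real \<Rightarrow> real.
        real_analytic_on \<kappa> {0.6..1} \<and>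
        strict_antimono_on {0.6..1} \<kappa> \<and>
        \<kappa> critical_density = 2 \<and>
        (\<forall>(n :: nat \<Rightarrow> nat) (k :: nat \<Rightarrow> nat) (\<mu> :: real).
           (\<forall>s. 1 \<le> k s \<and> 2 * k s + 1 \<le> n s) \<and>
           filterlim n at_top sequentially \<and> filterlim k at_top sequentially \<and>
           (\<lambda>s. 2 * real (k s) / real (n s)) \<longlonglongrightarrow> \<mu> \<and> \<mu> \<ge> 0.6 \<longrightarrow>
           (\<lambda>s. laplacian_ratio (n s) (k s)) \<longlonglongrightarrow> \<kappa> \<mu>)) \<and>
     (\<forall>\<epsilon>>0. \<exists>n k :: nat. 1 \<le> k \<and> 2 * k + 1 \<le> n \<and>
        (\<exists>\<theta>. stable_equilibrium K (circulant_adj n k) \<theta> \<and> unsynchronized \<theta>) \<and>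
        laplacian_ratio n k \<le> 2 + \<epsilon>)"
proof (intro conjI)
  show "\<forall>\<^sub>F n in sequentially. \<forall>k::nat. 1 \<le> k \<and> 2 * k + 1 \<le> n \<and> laplacian_ratio n k > 2 \<longrightarrow>
      (\<exists>\<theta>. stable_equilibrium K (circulant_adj n k) \<theta> \<and> unsynchronized \<theta>)"
    using stable_equilibrium_of_ratio_gt_2[OF assms]
    \<comment> \<open>The explicit threshold 20 comes from the bound on \<open>h\<close> in the
      comparison of frequencies with frequency 2.\<close>
    by (intro eventually_sequentiallyI[of 20]) blast
  show "\<exists>\<kappa>. real_analytic_on \<kappa> {0.6..1} \<and> strict_antimono_on {0.6..1} \<kappa> \<and> \<kappa> critical_density = 2 \<and>
      (\<forall>n k \<mu>. (\<forall>s. 1 \<le> k s \<and> 2 * k s + 1 \<le> n s) \<and>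
        filterlim n at_top sequentially \<and> filterlim k at_top sequentially \<and>
        (\<lambda>s. 2 * real (k s) / real (n s)) \<longlonglongrightarrow> \<mu> \<and> \<mu> \<ge> 0.6 \<longrightarrow>
        (\<lambda>s. laplacian_ratio (n s) (k s)) \<longlonglongrightarrow> \<kappa> \<mu>)"
    by (intro exI[of _ limit_ratio] conjI allI impI real_analytic_limit_ratio limit_ratio_decreasing
        critical_density(1) laplacian_ratio_limit) auto
  show "\<forall>\<epsilon>>0. \<exists>n k :: nat. 1 \<le> k \<and> 2 * k + 1 \<le> n \<and>
      (\<exists>\<theta>. stable_equilibrium K (circulant_adj n k) \<theta> \<and> unsynchronized \<theta>) \<and> laplacian_ratio n k \<le> 2 + \<epsilon>"
    using exists_stable_near_2[OF assms] by blast
qed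

end
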